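(* $\Lambda_1=\Lambda_2=1$, $\frac{\sqrt3}{2}\leq\Lambda_4\leq1$, and $\Lambda_n=\frac{\sqrt3}{2}$ for every $n\in(\mathbb{N}\cup\{\infty\})\setminus\{1,2,4\}$. Moreover, for $n\neq4$ there exist $g\in L_\infty(\Omega_n)$, $T\in\mathrm{Aut}_n$ and $z\in\mathbb{C}$ such that $\Lambda(g,T,z)=\Lambda(g)=\Lambda_n$.
   Context: For $n\in\mathbb{N}$, $(\Omega_n,\mu_n)$ is $\{1,\dots,n\}$ with normalized counting measure; $(\Omega_\infty,\mu_\infty)$ is $[0,1]$ with Lebesgue measure. $S(\Omega_n)$ is the set of complex measurable functions on $\Omega_n$; $\mathrm{Aut}_n$ the group of measure-preserving automorphisms (measurable bijections between full-measure subsets, with measurable inverse, preserving $\mu_n$). For $g\in S(\Omega_n)$, $T\in\mathrm{Aut}_n$, $z\in\mathbb{C}$: $\Lambda(g,T,z)=\operatorname{ess\,inf}\frac{|g-g\circ T|}{|g-z|+|g\circ T-z|}$ with $\frac00=1$; $\Lambda(g)=\sup_{T,z}\Lambda(g,T,z)$; $\Lambda_n=\inf_{g\in S(\Omega_n)}\Lambda(g)$. *)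

theory Defs
  imports "HOL-Analysis.Analysis"
begin

definition Omega_fin :: "nat \<Rightarrow> nat measure" where
  "Omega_fin n = uniform_count_measure {1..n}"

definition Omega_inf :: "real measure" where
  "Omega_inf = lebesgue_on {0..1}"

text \<open>Measure-preserving automorphisms: measurable bijections between full-measure
  measurable subsets A and B, with measurable inverse, preserving the measure.
  T is a total function whose values outside A are irrelevant.\<close>

definition Aut :: "'a measure \<Rightarrow> ('a \<Rightarrow> 'a) set" where
  "Aut M = {T. \<exists>A B. A \<in> sets M \<and> B \<in> sets M \<and>
      emeasure M (space M - A) = 0 \<and> emeasure M (space M - B) = 0 \<and>
      bij_betw T A B \<and>
      (\<forall>S\<in>sets M. S \<subseteq> B \<longrightarrow> T -` S \<inter> A \<in> sets M \<and> emeasure M (T -` S \<inter> A) = emeasure M S) \<and>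
      (\<forall>S\<in>sets M. S \<subseteq> A \<longrightarrow> T ` S \<in> sets M)}"

definition ess_inf :: "'a measure \<Rightarrow> ('a \<Rightarrow> real) \<Rightarrow> real" where
  "ess_inf M f = Sup {c. AE x in M. c \<le> f x}"

definition ratio :: "('a \<Rightarrow> complex) \<Rightarrow> ('a \<Rightarrow> 'a) \<Rightarrow> complex \<Rightarrow> 'a \<Rightarrow> real" where
  "ratio g T z x =
     (if cmod (g x - z) + cmod (g (T x) - z) = 0 then 1
      else cmod (g x - g (T x)) / (cmod (g x - z) + cmod (g (T x) - z)))"

definition Lam :: "'a measure \<Rightarrow> ('a \<Rightarrow> complex) \<Rightarrow> ('a \<Rightarrow> 'a) \<Rightarrow> complex \<Rightarrow> real" where
  "Lam M g T z = ess_inf M (ratio g T z)"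

definition LamSup :: "'a measure \<Rightarrow> ('a \<Rightarrow> complex) \<Rightarrow> real" where
  "LamSup M g = Sup {Lam M g T z | T z. T \<in> Aut M}"

definition LamInf :: "'a measure \<Rightarrow> real" where
  "LamInf M = Inf {LamSup M g | g. g \<in> borel_measurable M}"

definition Linf :: "'a measure \<Rightarrow> ('a \<Rightarrow> complex) set" where
  "Linf M = {g. g \<in> borel_measurable M \<and> (\<exists>C. AE x in M. cmod (g x) \<le> C)}"

end

theory Submission
  imports Defs "HOL-Probability.Probability"
begin

text \<open>If \<open>g x\<close> and \<open>g (T x)\<close> are seen from \<open>z\<close> under an angle \<open>\<phi>\<close>, the ratio at \<open>x\<close> is at least
  \<open>sin (\<phi> / 2)\<close>, so for the lower bound it suffices to make all these angles at least 120 degrees, up to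
  an arbitrarily small error.

  There is a point \<open>z\<close> such that no open 120 degree cone with apex \<open>z\<close> carries more than half of the
  distribution of \<open>g\<close>: two cones with more than half of the mass meet, hence the axes of the heavy cones
  at a given apex enclose angles below 120 degrees and their convex hull avoids 0. If every apex
  had a heavy cone, a partition of unity would turn the axes into a nowhere vanishing vector field on a
  disc that points inwards on the boundary, against Brouwer's theorem. For such a \<open>z\<close>, order the points by
  direction as seen from \<open>z\<close> and let \<open>T\<close> advance every point by half of the total mass. Both arcs
  between a point and its image then contain more than half of the mass, so neither is shorter than 120
  degrees.

  The value \<open>sqrt 3 / 2\<close> is attained by a function with values in the vertices of an equilateral
  triangle, each taken on less than half of the space: all three edges of the triangle have to be used by \<open>T\<close>,
  which otherwise would map two of the level sets into the third, and the distances from any \<open>z\<close> to the vertices add up to at least three times the circumradius. Such a function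
  exists for all \<open>n \<ge> 3\<close> except \<open>n = 4\<close>.\<close>

subsection \<open>Apexes without heavy cones\<close>

text \<open>For a unit vector \<open>d\<close> this is the open cone with apex 0, axis \<open>d\<close> and opening angle
  120 degrees.\<close>

definition sector :: "complex \<Rightarrow> complex set" where
  "sector d = {y. norm y < 2 * (y \<bullet> d)}"

lemma open_sector: "open (sector d)"
  unfolding sector_def by (intro open_Collect_less continuous_intros)

lemma sector_measurable [measurable]: "sector d \<in> sets borel"
  using open_sector by (rule borel_open)

text \<open>Both axes lie within less than 60 degrees of \<open>y\<close>, so they enclose an angle
  below 120 degrees. The proof avoids angles: along \<open>y\<close> both unit vectors have
  components above 1/2, hence orthogonal to it parts of norm below sqrt 3 / 2, and the inner product
  exceeds 1/4 - 3/4.\<close>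

lemma inner_gt_if_sectors_meet:
  fixes d e y :: complex
  assumes "norm d = 1" "norm e = 1" "y \<in> sector d" "y \<in> sector e"
  shows "d \<bullet> e > - 1 / 2"
proof -
  define u where "u = sgn y"
  have "y \<noteq> 0" using assms(3) by (auto simp: sector_def)
  hence nu: "norm u = 1" by (simp add: u_def norm_sgn)
  have ip: "u \<bullet> w > 1 / 2" if "y \<in> sector w" for w
    using that \<open>y \<noteq> 0\<close> by (simp add: sector_def u_def sgn_div_norm field_simps)
  have decomp: "d \<bullet> e = (u \<bullet> d) * (u \<bullet> e) + (d - (u \<bullet> d) *\<^sub>R u) \<bullet> (e - (u \<bullet> e) *\<^sub>R u)"
    using nu by (simp add: inner_diff_left inner_diff_right inner_commute dot_square_norm algebra_simps)
  have perp: "(norm (w - (u \<bullet> w) *\<^sub>R u))\<^sup>2 = 1 - (u \<bullet> w)\<^sup>2" if "norm w = 1" for w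
  proof -
    have "u \<bullet> u = 1" "w \<bullet> w = 1" using nu that by (simp_all add: dot_square_norm)
    thus ?thesis unfolding power2_norm_eq_inner
      by (simp add: inner_diff_left inner_diff_right inner_commute power2_eq_square)
  qed
  define a where "a = u \<bullet> d"
  define b where "b = u \<bullet> e"
  have ab: "a > 1/2" "b > 1/2" using ip assms unfolding a_def b_def by auto
  define P where "P = norm (d - a *\<^sub>R u)"
  define Q where "Q = norm (e - b *\<^sub>R u)"
  have P: "P\<^sup>2 < 3/4" "P \<ge> 0"
    using perp[OF assms(1)] ab(1) mult_strict_mono[of "1/2" a "1/2" a] unfolding P_def a_def
    by (auto simp: power2_eq_square)
  have Q: "Q\<^sup>2 < 3/4" "Q \<ge> 0"
    using perp[OF assms(2)] ab(2) mult_strict_mono[of "1/2" b "1/2" b] unfolding Q_def b_def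
    by (auto simp: power2_eq_square)
  have "2 * (P * Q) \<le> P\<^sup>2 + Q\<^sup>2" using sum_squares_bound[of P Q] by simp
  hence "P * Q < 3/4" using P Q by linarith
  moreover have "\<bar>(d - a *\<^sub>R u) \<bullet> (e - b *\<^sub>R u)\<bar> \<le> P * Q"
    unfolding P_def Q_def by (rule Cauchy_Schwarz_ineq2)
  moreover have "a * b > 1/4" using mult_strict_mono[of "1/2" a "1/2" b] ab by simp
  ultimately show ?thesis unfolding decomp a_def[symmetric] b_def[symmetric] by linarith
qed

text \<open>By Caratheodory three vectors suffice; testing a vanishing convex combination against the
  vector with the largest coefficient gives a contradiction.\<close>

lemma zero_notin_convex_hull:
  fixes D :: "complex set"
  assumes unit: "\<And>d. d \<in> D \<Longrightarrow> norm d = 1"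
    and angle: "\<And>d e. d \<in> D \<Longrightarrow> e \<in> D \<Longrightarrow> d \<bullet> e > - 1 / 2"
  shows "0 \<notin> convex hull D"
proof
  assume "0 \<in> convex hull D"
  then obtain S where S: "finite S" "S \<subseteq> D" "card S \<le> DIM(complex) + 1" "0 \<in> convex hull S"
    using caratheodory[of D] by auto
  from S(4) obtain c where c: "\<And>x. x \<in> S \<Longrightarrow> c x \<ge> 0" "sum c S = 1" "(\<Sum>x\<in>S. c x *\<^sub>R x) = 0"
    unfolding convex_hull_finite[OF S(1)] by auto
  have "S \<noteq> {}" using c(2) by auto
  obtain m where m: "m \<in> S" "\<And>x. x \<in> S \<Longrightarrow> c x \<le> c m"
    using obtains_MAX[OF S(1) \<open>S \<noteq> {}\<close>, of c] S(1) by (metis Max_ge finite_imageI imageI)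
  have "card (S - {m}) \<le> 2" using S(1,3) m(1) by (simp add: card_Diff_singleton)
  have "0 = (\<Sum>x\<in>S. c x *\<^sub>R x) \<bullet> m" using c(3) by simp
  also have "\<dots> = (\<Sum>x\<in>S. c x * (x \<bullet> m))" by (simp add: inner_sum_left)
  also have "\<dots> = c m * (m \<bullet> m) + (\<Sum>x\<in>S - {m}. c x * (x \<bullet> m))"
    using S(1) m(1) by (rule sum.remove)
  also have "m \<bullet> m = 1" using unit S(2) m(1) by (metis subsetD norm_eq_1)
  finally have eq: "0 = c m + (\<Sum>x\<in>S - {m}. c x * (x \<bullet> m))" by simp
  have "c m > 0"
  proof (rule ccontr)
    assume "\<not> c m > 0"
    hence "\<And>x. x \<in> S \<Longrightarrow> c x = 0" using m(2) c(1) by force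
    thus False using c(2) by simp
  qed
  have lt: "c x * (x \<bullet> m) > - (c m / 2)" if "x \<in> S - {m}" for x
  proof -
    have g: "x \<bullet> m > - 1 / 2" using that angle S(2) m(1) by blast
    have "c x \<ge> 0" "c x \<le> c m" using that c m by auto
    show "c x * (x \<bullet> m) > - (c m / 2)"
    proof (cases "c x = 0")
      case True thus ?thesis using \<open>c m > 0\<close> by simp
    next
      case False
      hence "c x * (x \<bullet> m) > c x * (- 1/2)" using g \<open>c x \<ge> 0\<close> by (intro mult_strict_left_mono) auto
      thus ?thesis using \<open>c x \<le> c m\<close> by linarith
    qed
  qed
  show False
  proof (cases "S - {m} = {}")
    case True show ?thesis using eq \<open>c m > 0\<close> unfolding True by simp
  next
    case False
    have "(\<Sum>x\<in>S - {m}. c x * (x \<bullet> m)) > (\<Sum>x\<in>S - {m}. - (c m / 2))"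
      using lt False S(1) by (intro sum_strict_mono) auto
    moreover have "(\<Sum>x\<in>S - {m}. - (c m / 2)) \<ge> - c m"
      using \<open>card (S - {m}) \<le> 2\<close> \<open>c m > 0\<close> by (simp add: field_simps)
    ultimately show False using eq by linarith
  qed
qed

section \<open>Zeros of vector fields and balanced apexes\<close>

text \<open>Brouwer's theorem is applied to \<open>z + V z\<close> followed by the radial retraction
  onto the ball. A fixed point that has been retracted lies on the sphere and has \<open>V z\<close>
  a nonnegative multiple of \<open>z\<close>, which \<open>bd\<close> excludes; at any other fixed
  point \<open>V\<close> vanishes.\<close>

lemma continuous_field_zero_in_ball:
  fixes V :: "complex \<Rightarrow> complex"
  assumes "r > 0" and cont: "continuous_on (cball 0 r) V"
    and bd: "\<And>z t. norm z = r \<Longrightarrow> t \<ge> 0 \<Longrightarrow> V z \<noteq> t *\<^sub>R z"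
  shows "\<exists>z\<in>cball 0 r. V z = 0"
proof -
  define f where "f = (\<lambda>z. (r / max r (norm (z + V z))) *\<^sub>R (z + V z))"
  have "continuous_on (cball 0 r) f"
    unfolding f_def using \<open>r > 0\<close> by (intro continuous_intros cont) auto
  moreover have "f \<in> cball 0 r \<rightarrow> cball 0 r"
  proof
    fix z
    have "r / max r q * q \<le> r" if "q \<ge> 0" for q
      using \<open>r > 0\<close> that by (auto simp: max_def field_simps)
    thus "f z \<in> cball 0 r" using \<open>r > 0\<close> by (simp add: f_def)
  qed
  ultimately obtain z where z: "z \<in> cball 0 r" "f z = z"
    using brouwer[of "cball 0 r" f] \<open>r > 0\<close> by (metis cball_eq_empty compact_cball convex_cball not_less_iff_gr_or_eq)
  show ?thesis
  proof (cases "norm (z + V z) \<le> r")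
    case True
    hence "f z = z + V z" using \<open>r > 0\<close> by (simp add: f_def max_def)
    thus ?thesis using z by auto
  next
    case False
    define q where "q = norm (z + V z)"
    have q: "q > r" using False by (simp add: q_def)
    have fz: "z = (r / q) *\<^sub>R (z + V z)" using z(2) q by (simp add: f_def q_def max_def)
    hence "norm z = (r / q) * q" using \<open>r > 0\<close> q
      by (metis abs_of_pos divide_pos_pos less_trans norm_scaleR q_def)
    hence "norm z = r" using q \<open>r > 0\<close> by simp
    moreover have "V z = (q / r - 1) *\<^sub>R z"
    proof -
      have "(q / r) *\<^sub>R z = (q / r) *\<^sub>R ((r / q) *\<^sub>R (z + V z))" using fz by simp
      also have "\<dots> = z + V z" using q \<open>r > 0\<close> by simp
      finally show ?thesis by (simp add: algebra_simps)
    qed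
    moreover have "q / r - 1 \<ge> 0" using q \<open>r > 0\<close> by simp
    ultimately show ?thesis using bd by blast
  qed
qed

context finite_measure
begin

lemma heavy_apexes_open:
  fixes g :: "'a \<Rightarrow> complex"
  assumes [measurable]: "g \<in> borel_measurable M" and "norm d = 1"
  shows "open {z. measure M {x \<in> space M. g x - z \<in> sector d} > c}"
proof (rule openI)
  fix z assume "z \<in> {z. measure M {x \<in> space M. g x - z \<in> sector d} > c}"
  hence heavy: "measure M {x \<in> space M. g x - z \<in> sector d} > c" by simp
  define S where "S = (\<lambda>j::nat. {x \<in> space M. norm (g x - z) + 3 / (real j + 1) < 2 * ((g x - z) \<bullet> d)})"
  have [measurable, simp]: "S j \<in> sets M" for j unfolding S_def by measurable
  have "incseq S"
  proof (rule incseq_SucI)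
    fix j
    have "3 / (real (Suc j) + 1) \<le> 3 / (real j + 1)" by (simp add: field_simps)
    thus "S j \<subseteq> S (Suc j)" unfolding S_def by force
  qed
  have "(\<Union>j. S j) = {x \<in> space M. g x - z \<in> sector d}"
  proof (intro equalityI subsetI)
    fix x assume "x \<in> (\<Union>j. S j)"
    then obtain j where j: "x \<in> S j" by auto
    have "3 / (real j + 1) > 0" by simp
    thus "x \<in> {x \<in> space M. g x - z \<in> sector d}" using j unfolding S_def sector_def mem_Collect_eq by linarith
  next
    fix x assume x: "x \<in> {x \<in> space M. g x - z \<in> sector d}"
    then obtain j where "inverse (real (Suc j)) < (2 * ((g x - z) \<bullet> d) - norm (g x - z)) / 3"
      using reals_Archimedean[of "(2 * ((g x - z) \<bullet> d) - norm (g x - z)) / 3"] by (auto simp: sector_def)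
    hence "x \<in> S j" using x by (auto simp: S_def field_simps)
    thus "x \<in> (\<Union>j. S j)" by blast
  qed
  hence "(\<lambda>j. measure M (S j)) \<longlonglongrightarrow> measure M {x \<in> space M. g x - z \<in> sector d}"
    using finite_Lim_measure_incseq[of S] \<open>incseq S\<close> by (simp add: image_subset_iff)
  hence "\<forall>\<^sub>F j in sequentially. measure M (S j) > c" using heavy by (rule order_tendstoD)
  then obtain j where j: "measure M (S j) > c" using eventually_happens'[OF sequentially_bot] by blast
  show "\<exists>e>0. ball z e \<subseteq> {z. measure M {x \<in> space M. g x - z \<in> sector d} > c}"
  proof (intro exI conjI subsetI)
    show "1 / (real j + 1) > 0" by simp
    fix w assume w: "w \<in> ball z (1 / (real j + 1))"
    hence dw: "norm (z - w) < 1 / (real j + 1)" by (simp add: dist_norm)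
    have "S j \<subseteq> {x \<in> space M. g x - w \<in> sector d}"
    proof
      fix x assume x: "x \<in> S j"
      have "norm (g x - w) \<le> norm (g x - z) + norm (z - w)"
        using norm_triangle_ineq[of "g x - z" "z - w"] by simp
      moreover have "(g x - w) \<bullet> d = (g x - z) \<bullet> d + (z - w) \<bullet> d" by (simp add: inner_diff_left)
      moreover have "\<bar>(z - w) \<bullet> d\<bar> \<le> norm (z - w)"
        using Cauchy_Schwarz_ineq2[of "z - w" d] assms(2) by simp
      ultimately show "x \<in> {x \<in> space M. g x - w \<in> sector d}" using x dw unfolding S_def sector_def by auto
    qed
    hence "measure M (S j) \<le> measure M {x \<in> space M. g x - w \<in> sector d}"
      by (intro finite_measure_mono) auto
    thus "w \<in> {z. measure M {x \<in> space M. g x - z \<in> sector d} > c}" using j by simp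
  qed
qed

lemma heavy_sets_meet:
  assumes "A \<in> sets M" "B \<in> sets M" "measure M A > measure M (space M) / 2" "measure M B > measure M (space M) / 2"
  shows "A \<inter> B \<noteq> {}"
proof
  assume "A \<inter> B = {}"
  hence "measure M (A \<union> B) = measure M A + measure M B" using assms by (intro finite_measure_Union) auto
  moreover have "measure M (A \<union> B) \<le> measure M (space M)" by (rule bounded_measure)
  ultimately show False using assms by linarith
qed

lemma exists_balanced_apex:
  fixes g :: "'a \<Rightarrow> complex"
  assumes g [measurable]: "g \<in> borel_measurable M"
  shows "\<exists>z. \<forall>d. norm d = 1 \<longrightarrow>
    measure M {x \<in> space M. g x - z \<in> sector d} \<le> measure M (space M) / 2"
proof (cases "measure M (space M) = 0")
  case True
  thus ?thesis by (metis bounded_measure div_0)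
next
  case False
  define W where "W = measure M (space M)"
  have "W > 0" using False by (simp add: W_def zero_less_measure_iff)
  define U where "U = (\<lambda>d. {z. measure M {x \<in> space M. g x - z \<in> sector d} > W / 2})"
  have pairwise: "d \<bullet> e > - 1 / 2"
    if "norm d = 1" "norm e = 1" "z \<in> U d" "z \<in> U e" for d e z
  proof -
    have "{x \<in> space M. g x - z \<in> sector d} \<inter> {x \<in> space M. g x - z \<in> sector e} \<noteq> {}"
      using that unfolding U_def W_def by (intro heavy_sets_meet) auto
    then obtain x where "g x - z \<in> sector d" "g x - z \<in> sector e" by auto
    thus ?thesis using that inner_gt_if_sectors_meet by blast
  qed
  have "(\<lambda>k. measure M {x \<in> space M. norm (g x) < real k}) \<longlonglongrightarrow>
      measure M (\<Union>k. {x \<in> space M. norm (g x) < real k})"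
    by (intro finite_Lim_measure_incseq) (auto simp: incseq_def)
  also have "(\<Union>k. {x \<in> space M. norm (g x) < real k}) = space M"
    using reals_Archimedean2 by auto
  finally have "\<forall>\<^sub>F k in sequentially. measure M {x \<in> space M. norm (g x) < real k} > W / 2"
    using \<open>W > 0\<close> unfolding W_def by (intro order_tendstoD) auto
  then obtain k where k: "measure M {x \<in> space M. norm (g x) < real k} > W / 2"
    using eventually_happens'[OF sequentially_bot] by blast
  \<comment> \<open>An apex of norm \<open>r\<close> sees the ball of radius \<open>k\<close>, which
    carries more than half of the mass, inside the cone whose axis points to the origin: the
    estimates below need \<open>3 * norm (g x) < r\<close>.\<close>
  define r where "r = 3 * real k + 1"
  have "r > 0" by (simp add: r_def add_nonneg_pos)
  have far: "z \<in> U (- (z /\<^sub>R r))" if "norm z = r" for z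
  proof -
    have "{x \<in> space M. norm (g x) < real k} \<subseteq> {x \<in> space M. g x - z \<in> sector (- (z /\<^sub>R r))}"
    proof safe
      fix x assume x: "norm (g x) < real k"
      have "(g x - z) \<bullet> (- (z /\<^sub>R r)) = r - (g x \<bullet> z) / r"
        using that \<open>r > 0\<close> by (simp add: inner_diff_left dot_square_norm power2_eq_square field_simps)
      moreover have "\<bar>g x \<bullet> z\<bar> \<le> norm (g x) * r" using Cauchy_Schwarz_ineq2[of "g x" z] that by simp
      hence "(g x \<bullet> z) / r \<le> norm (g x)" using \<open>r > 0\<close> by (simp add: field_simps)
      moreover have "norm (g x - z) \<le> norm (g x) + r" using norm_triangle_ineq4[of "g x" z] that by simp
      ultimately show "g x - z \<in> sector (- (z /\<^sub>R r))" using x unfolding sector_def r_def by auto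
    qed
    hence "measure M {x \<in> space M. norm (g x) < real k} \<le> measure M {x \<in> space M. g x - z \<in> sector (- (z /\<^sub>R r))}"
      by (intro finite_measure_mono) auto
    thus ?thesis using k by (simp add: U_def)
  qed
  show ?thesis
  proof (rule ccontr)
    assume "\<not> ?thesis"
    hence cover: "\<And>z. \<exists>d. norm d = 1 \<and> z \<in> U d" unfolding U_def W_def by (force simp: not_le)
    have "cball 0 r \<subseteq> (\<Union>d\<in>sphere 0 1. U d)" using cover by force
    moreover have openU: "open (U d)" if "d \<in> sphere 0 1" for d
      unfolding U_def using that by (intro heavy_apexes_open) auto
    ultimately obtain D where D: "D \<subseteq> sphere 0 1" "finite D" "cball 0 r \<subseteq> (\<Union>d\<in>D. U d)"
      using compactE_image[OF compact_cball, of "sphere 0 1" U "0::complex" r] by blast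
    \<comment> \<open>Unnormalised weights of a partition of unity subordinate to the
      \<open>U d\<close>. The case \<open>U d = UNIV\<close> is separate because
      \<open>infdist\<close> to the empty set is 0.\<close>
    define \<rho> where "\<rho> = (\<lambda>d z. if U d = UNIV then 1 else infdist z (- U d))"
    have \<rho>0: "\<rho> d z \<ge> 0" for d z by (simp add: \<rho>_def infdist_nonneg)
    have \<rho>pos: "\<rho> d z > 0 \<longleftrightarrow> z \<in> U d" if "d \<in> D" for d z
    proof (cases "U d = UNIV")
      case False
      hence "z \<in> - U d \<longleftrightarrow> infdist z (- U d) = 0"
        using openU[OF subsetD[OF D(1) that]]
        by (intro in_closed_iff_infdist_zero) (auto simp: closed_Compl)
      thus ?thesis using False infdist_nonneg[of z "- U d"] by (auto simp: \<rho>_def less_le)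
    qed (simp add: \<rho>_def)
    define V where "V = (\<lambda>z. \<Sum>d\<in>D. \<rho> d z *\<^sub>R d)"
    have "continuous_on (cball 0 r) V"
    proof -
      have "continuous_on (cball 0 r) (\<rho> d)" for d
        by (cases "U d = UNIV") (auto simp: \<rho>_def intro!: continuous_intros)
      thus ?thesis unfolding V_def by (intro continuous_intros)
    qed
    \<comment> \<open>With \<open>t = 0\<close> this says that \<open>V\<close> has no zero. With
      \<open>t > 0\<close> and \<open>e\<close> the axis towards the origin, which is heavy at every
      apex on the sphere, it gives the boundary condition for the zero theorem.\<close>
    have nz: "V z + t *\<^sub>R e \<noteq> 0"
      if z: "z \<in> cball 0 r" and t: "t \<ge> 0" and e: "t = 0 \<or> norm e = 1 \<and> z \<in> U e" for z t e
    proof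
      assume eq: "V z + t *\<^sub>R e = 0"
      define E where "E = {d \<in> D. z \<in> U d} \<union> (if t = 0 then {} else {e})"
      have "0 \<notin> convex hull E"
        using D(1) e by (intro zero_notin_convex_hull pairwise) (auto simp: E_def split: if_splits)
      define s where "s = (\<Sum>d\<in>D. \<rho> d z) + t"
      have "\<exists>d\<in>D. \<rho> d z > 0" using D(3) z \<rho>pos by blast
      hence "(\<Sum>d\<in>D. \<rho> d z) > 0" using D(2) \<rho>0 by (meson sum_pos2)
      hence "s > 0" using t by (simp add: s_def)
      obtain d0 where d0: "d0 \<in> D" "z \<in> U d0" using D(3) z by blast
      \<comment> \<open>Axes that are not heavy at \<open>z\<close> have weight 0; replacing them by
        the heavy axis \<open>d0\<close> leaves the sum unchanged and puts all its points into
        \<open>E\<close>. The index \<open>None\<close> carries the additional vector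
        \<open>e\<close>.\<close>
      define F where "F = (\<lambda>d. if d \<in> E then d else d0)"
      have "(\<Sum>i\<in>insert None (Some ` D). (case i of None \<Rightarrow> t / s | Some d \<Rightarrow> \<rho> d z / s) *\<^sub>R
          (case i of None \<Rightarrow> F e | Some d \<Rightarrow> F d)) \<in> convex hull E"
      proof (rule convex_sum[OF _ convex_convex_hull])
        show "(\<Sum>i\<in>insert None (Some ` D). case i of None \<Rightarrow> t / s | Some d \<Rightarrow> \<rho> d z / s) = 1"
          using D(2) \<open>s > 0\<close>
          by (simp add: sum.reindex s_def sum_divide_distrib[symmetric] add_divide_distrib[symmetric] add.commute)
      qed (use D(2) \<open>s > 0\<close> t \<rho>0 d0 in \<open>auto intro!: hull_inc simp: F_def E_def\<close>)
      also have "(\<Sum>i\<in>insert None (Some ` D). (case i of None \<Rightarrow> t / s | Some d \<Rightarrow> \<rho> d z / s) *\<^sub>R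
          (case i of None \<Rightarrow> F e | Some d \<Rightarrow> F d)) = (t / s) *\<^sub>R F e + (\<Sum>d\<in>D. (\<rho> d z / s) *\<^sub>R F d)"
        using D(2) by (simp add: sum.reindex)
      also have "(t / s) *\<^sub>R F e = (t / s) *\<^sub>R e" by (auto simp: F_def E_def)
      also have "(\<Sum>d\<in>D. (\<rho> d z / s) *\<^sub>R F d) = (\<Sum>d\<in>D. (\<rho> d z / s) *\<^sub>R d)"
      proof (rule sum.cong)
        fix d assume "d \<in> D"
        thus "(\<rho> d z / s) *\<^sub>R F d = (\<rho> d z / s) *\<^sub>R d"
          using \<rho>pos[of d z] \<rho>0[of d z] by (auto simp: F_def E_def less_le)
      qed simp
      also have "(t / s) *\<^sub>R e + (\<Sum>d\<in>D. (\<rho> d z / s) *\<^sub>R d) = (V z + t *\<^sub>R e) /\<^sub>R s"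
        by (simp add: V_def scaleR_add_right scaleR_sum_right divide_inverse_commute add.commute)
      finally show False using eq \<open>0 \<notin> convex hull E\<close> by simp
    qed
    have "\<exists>z\<in>cball 0 r. V z = 0"
    proof (rule continuous_field_zero_in_ball)
      fix z :: complex and t :: real assume z: "norm z = r" and t: "t \<ge> 0"
      have "V z + (t * r) *\<^sub>R (- (z /\<^sub>R r)) \<noteq> 0"
        using z t \<open>r > 0\<close> far[OF z] by (intro nz) auto
      thus "V z \<noteq> t *\<^sub>R z" using \<open>r > 0\<close> by auto
    qed fact+
    thus False using nz[of _ 0] by auto
  qed
qed

end

text \<open>Points with \<open>g x = z\<close> have no direction; they get the directions \<open>e\<close> and \<open>-e\<close>, where \<open>e\<close> is the
  limit of axes of cones whose masses tend to the supremum \<open>p\<close>. Giving mass \<open>W / 2 - p\<close> to \<open>e\<close> fills these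
  cones up to half of the total mass \<open>W\<close>, and every cone containing \<open>-e\<close> is disjoint from them.\<close>

lemma (in finite_measure) exists_balanced_directions:
  fixes g :: "'a \<Rightarrow> complex"
  assumes g [measurable]: "g \<in> borel_measurable M"
    and bal: "\<And>d. norm d = 1 \<Longrightarrow>
      measure M {x \<in> space M. g x - z \<in> sector d} \<le> measure M (space M) / 2"
    and split: "measure M {x \<in> space M. g x = z} >
        measure M (space M) / 2 - (SUP d\<in>sphere 0 1. measure M {x \<in> space M. g x - z \<in> sector d}) \<Longrightarrow>
      \<exists>C\<in>sets M. C \<subseteq> {x \<in> space M. g x = z} \<and> measure M C =
        measure M (space M) / 2 - (SUP d\<in>sphere 0 1. measure M {x \<in> space M. g x - z \<in> sector d})"
  shows "\<exists>u \<in> borel_measurable M. (\<forall>x\<in>space M. norm (u x) = 1 \<and> (g x \<noteq> z \<longrightarrow> u x = sgn (g x - z))) \<and>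
    (\<forall>d. norm d = 1 \<longrightarrow> measure M {x \<in> space M. u x \<in> sector d} \<le> measure M (space M) / 2)"
proof -
  define W where "W = measure M (space M)"
  define C where "C = {x \<in> space M. g x = z}"
  have [measurable]: "C \<in> sets M" unfolding C_def by measurable
  define h where "h = (\<lambda>d. measure M {x \<in> space M. g x - z \<in> sector d})"
  define p where "p = Sup (h ` sphere 0 1)"
  have hW: "h d \<le> W / 2" if "norm d = 1" for d using bal that by (simp add: h_def W_def)
  hence bdd: "bdd_above (h ` sphere 0 1)" by (auto intro!: bdd_aboveI[of _ "W / 2"])
  have hp: "h d \<le> p" if "norm d = 1" for d
    unfolding p_def using that bdd by (intro cSup_upper) auto
  have ne: "h ` sphere 0 1 \<noteq> {}" by auto
  have pW: "p \<le> W / 2" unfolding p_def using hW ne by (intro cSup_least) auto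
  have approx: "\<exists>e. norm e = 1 \<and> q < h e" if "q < p" for q
    using less_cSupD[OF ne] that unfolding p_def by (metis imageE mem_sphere_0)
  have "\<forall>k::nat. \<exists>e. norm e = 1 \<and> p - 1 / (real k + 1) < h e"
    by (intro allI approx) simp
  then obtain \<epsilon> where \<epsilon>: "\<And>k. norm (\<epsilon> k) = 1" "\<And>k::nat. p - 1 / (real k + 1) < h (\<epsilon> k)" by metis
  have "\<forall>k. \<epsilon> k \<in> sphere 0 1" using \<epsilon> by simp
  then obtain e r where e: "e \<in> sphere 0 1" "strict_mono r" "(\<epsilon> \<circ> r) \<longlonglongrightarrow> e"
    using compact_sphere[of "0::complex" 1] unfolding compact_def by blast
  have ne1: "norm e = 1" using e by simp
  have lim: "(\<lambda>k. h (\<epsilon> (r k))) \<longlonglongrightarrow> p"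
  proof (rule tendsto_sandwich[where h = "\<lambda>_. p"])
    have "(\<lambda>k. p - 1 / (real k + 1)) \<longlonglongrightarrow> p" by real_asymp
    from LIMSEQ_subseq_LIMSEQ[OF this e(2)]
    show "(\<lambda>k. p - 1 / (real (r k) + 1)) \<longlonglongrightarrow> p" by (simp add: o_def)
  qed (use \<epsilon> hp in \<open>auto intro!: always_eventually simp: less_imp_le\<close>)
  \<comment> \<open>\<open>C1\<close> is the part of \<open>C\<close> that gets direction
    \<open>e\<close>. It has mass \<open>W / 2 - p\<close> if \<open>C\<close> is large enough, by
    \<open>split\<close>; otherwise all of \<open>C\<close> goes to \<open>e\<close>.\<close>
  obtain C1 where C1 [measurable]: "C1 \<in> sets M" and C1C: "C1 \<subseteq> C"
    and mC1: "measure M C1 \<le> W / 2 - p" and mC1': "measure M C1 = W / 2 - p \<or> C1 = C"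
  proof (cases "measure M C > W / 2 - p")
    case True
    have "\<exists>C1\<in>sets M. C1 \<subseteq> C \<and> measure M C1 = W / 2 - p"
      using split True unfolding C_def W_def p_def h_def by simp
    thus ?thesis using that by auto
  next
    case False
    thus ?thesis using that[of C] by auto
  qed
  define u where "u = (\<lambda>x. if x \<in> C1 then e else if x \<in> C then - e else sgn (g x - z))"
  have [measurable]: "u \<in> borel_measurable M" unfolding u_def sgn_div_norm by measurable
  have nz: "x \<notin> C" if "x \<in> space M" "g x - z \<in> sector d" for x d
    using that by (auto simp: C_def sector_def)
  have sec: "sgn y \<in> sector d \<longleftrightarrow> y \<in> sector d" for y d
    by (cases "y = 0") (auto simp: sector_def sgn_div_norm field_simps norm_sgn)
  have main: "measure M {x \<in> space M. u x \<in> sector d} \<le> W / 2" if d: "norm d = 1" for d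
  proof -
    define H where "H = {x \<in> space M. g x - z \<in> sector d}"
    have [measurable]: "H \<in> sets M" unfolding H_def by measurable
    have mH: "measure M H = h d" by (simp add: H_def h_def)
    have notboth: "\<not> (e \<in> sector d \<and> - e \<in> sector d)"
      by (auto simp: sector_def) (smt (verit) norm_ge_zero)
    have sub: "{x \<in> space M. u x \<in> sector d} \<subseteq>
        H \<union> ((if e \<in> sector d then C1 else {}) \<union> (if - e \<in> sector d then C - C1 else {}))"
      using C1C by (auto simp: u_def H_def sec C_def)
    consider "e \<in> sector d" "- e \<notin> sector d" | "- e \<in> sector d" "e \<notin> sector d" | "e \<notin> sector d" "- e \<notin> sector d"
      using notboth by blast
    thus ?thesis
    proof cases
      case 1
      have "measure M {x \<in> space M. u x \<in> sector d} \<le> measure M (H \<union> C1)"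
        using sub 1 by (intro finite_measure_mono) auto
      also have "\<dots> \<le> measure M H + measure M C1" by (intro measure_Un_le) auto
      finally show ?thesis using hp[OF d] mC1 mH by simp
    next
      case 2
      have le: "measure M {x \<in> space M. u x \<in> sector d} \<le> measure M H + measure M (C - C1)"
        using sub 2 by (intro order.trans[OF finite_measure_mono measure_Un_le]) auto
      show ?thesis
      proof (cases "C1 = C")
        case True
        thus ?thesis using le hW[OF d] mH by simp
      next
        case False
        hence m1: "measure M C1 = W / 2 - p" using mC1' by blast
        \<comment> \<open>Since \<open>-e\<close> lies in the cone of \<open>d\<close>, the angle
          between \<open>d\<close> and \<open>e\<close> exceeds 120 degrees. Hence the cones around
          the approximating axes are eventually disjoint from that of \<open>d\<close> and from
          \<open>C\<close>, and in the limit \<open>p + h d\<close> is at most the mass outside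
          \<open>C\<close>.\<close>
        have "((\<lambda>k. d \<bullet> \<epsilon> (r k)) \<longlongrightarrow> d \<bullet> e) sequentially"
          using e(3) by (intro tendsto_intros) (simp add: o_def)
        moreover have "d \<bullet> e < - 1 / 2" using 2 ne1 by (simp add: sector_def inner_commute)
        ultimately have "\<forall>\<^sub>F k in sequentially. d \<bullet> \<epsilon> (r k) < - 1 / 2" by (rule order_tendstoD)
        hence ev: "\<forall>\<^sub>F k in sequentially. h (\<epsilon> (r k)) \<le> W - measure M C - h d"
        proof eventually_elim
          case (elim k)
          define K where "K = {x \<in> space M. g x - z \<in> sector (\<epsilon> (r k))}"
          have [measurable]: "K \<in> sets M" unfolding K_def by measurable
          have "H \<inter> K = {}"
          proof (rule ccontr)
            assume "H \<inter> K \<noteq> {}"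
            then obtain x where "g x - z \<in> sector d" "g x - z \<in> sector (\<epsilon> (r k))"
              by (auto simp: H_def K_def)
            hence "d \<bullet> \<epsilon> (r k) > - 1 / 2" using inner_gt_if_sectors_meet d \<epsilon>(1) by blast
            thus False using elim by simp
          qed
          moreover have "(H \<union> K) \<inter> C = {}" using nz by (auto simp: H_def K_def)
          ultimately have "measure M (H \<union> K \<union> C) = measure M H + measure M K + measure M C"
            by (subst finite_measure_Union; simp add: finite_measure_Union)
          moreover have "measure M (H \<union> K \<union> C) \<le> W" unfolding W_def by (rule bounded_measure)
          moreover have "measure M K = h (\<epsilon> (r k))" by (simp add: K_def h_def)
          ultimately show ?case using mH by simp
        qed
        have "p \<le> W - measure M C - h d" using lim ev by (intro tendsto_upperbound) auto
        moreover have "measure M (C - C1) = measure M C - measure M C1"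
          using C1C by (intro finite_measure_Diff) auto
        ultimately show ?thesis using le m1 mH by simp
      qed
    next
      case 3
      have "measure M {x \<in> space M. u x \<in> sector d} \<le> measure M H"
        using sub 3 by (intro finite_measure_mono) auto
      thus ?thesis using hW[OF d] mH by simp
    qed
  qed
  show ?thesis
  proof (intro bexI conjI ballI allI impI)
    show "u \<in> borel_measurable M" by measurable
    fix x assume x: "x \<in> space M"
    show "norm (u x) = 1" using x ne1 by (auto simp: u_def C_def norm_sgn)
    assume "g x \<noteq> z"
    thus "u x = sgn (g x - z)" using C1C by (auto simp: u_def C_def)
  qed (use main in \<open>simp add: W_def\<close>)
qed

subsection \<open>Ratios and angles\<close>

lemma ratio_le_1: "ratio g T z x \<le> 1"
proof -
  have "cmod (g x - g (T x)) \<le> cmod (g x - z) + cmod (g (T x) - z)"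
    using norm_triangle_ineq4[of "g x - z" "g (T x) - z"] by simp
  moreover have "cmod (g x - z) + cmod (g (T x) - z) \<ge> 0" by (intro add_nonneg_nonneg) auto
  ultimately show ?thesis unfolding ratio_def by (auto simp: divide_le_eq_1 less_le simp del: add_nonneg_eq_0_iff)
qed

lemma ratio_nonneg: "ratio g T z x \<ge> 0"
  by (simp add: ratio_def)

lemma ratio_center: "g x = z \<or> g (T x) = z \<Longrightarrow> ratio g T z x = 1"
  by (auto simp: ratio_def norm_minus_commute)

text \<open>With \<open>r, s\<close> the distances of \<open>a, b\<close> from \<open>z\<close> and \<open>c\<close> the cosine of the angle at \<open>z\<close>,
  \<open>r\<^sup>2 + s\<^sup>2 - 2 r s c - (r + s)\<^sup>2 (1 - c) / 2 = (r - s)\<^sup>2 (1 + c) / 2\<close>.\<close>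

lemma dist_ge_if_angle_large:
  fixes a b z :: complex
  assumes "a \<noteq> z" "b \<noteq> z" and c: "sgn (a - z) \<bullet> sgn (b - z) \<le> 1 - 2 * k" and "k \<ge> 0"
  shows "sqrt k * (cmod (a - z) + cmod (b - z)) \<le> cmod (a - b)"
proof -
  define r where "r = cmod (a - z)"
  define s where "s = cmod (b - z)"
  define c where "c = sgn (a - z) \<bullet> sgn (b - z)"
  have rs: "r > 0" "s > 0" using assms by (auto simp: r_def s_def)
  have "a - z = r *\<^sub>R sgn (a - z)" "b - z = s *\<^sub>R sgn (b - z)"
    using rs by (auto simp: r_def s_def sgn_div_norm)
  hence "(a - z) \<bullet> (b - z) = r * s * c"
    by (metis c_def inner_scaleR_left inner_scaleR_right mult.assoc)
  moreover have "(cmod ((a - z) - (b - z)))\<^sup>2 = r\<^sup>2 + s\<^sup>2 - 2 * ((a - z) \<bullet> (b - z))"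
    unfolding r_def s_def power2_norm_eq_inner by (simp add: inner_diff_left inner_diff_right inner_commute)
  ultimately have eq: "(cmod (a - b))\<^sup>2 = r\<^sup>2 + s\<^sup>2 - 2 * r * s * c" by simp
  have "\<bar>c\<bar> \<le> 1" using Cauchy_Schwarz_ineq2[of "sgn (a - z)" "sgn (b - z)"] assms
    by (simp add: c_def norm_sgn)
  hence "(r - s)\<^sup>2 * (1 + c) \<ge> 0" by (intro mult_nonneg_nonneg) auto
  moreover have "(r + s)\<^sup>2 * (2 * k) \<le> (r + s)\<^sup>2 * (1 - c)"
    using c unfolding c_def by (intro mult_left_mono) auto
  ultimately have "k * (r + s)\<^sup>2 \<le> (cmod (a - b))\<^sup>2"
    unfolding eq by (simp add: power2_eq_square algebra_simps)
  hence "sqrt (k * (r + s)\<^sup>2) \<le> sqrt ((cmod (a - b))\<^sup>2)" by (rule real_sqrt_le_mono)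
  thus ?thesis using rs by (simp add: real_sqrt_mult r_def s_def)
qed

text \<open>\<open>k\<close> is the squared sine of half an angle with cosine
  \<open>1 - 2 * k\<close>. No angle is demanded where one of the two values is \<open>z\<close>,
  since the ratio is 1 there.\<close>

lemma ratio_ge_if_angle_large:
  assumes "g x \<noteq> z \<Longrightarrow> g (T x) \<noteq> z \<Longrightarrow> sgn (g x - z) \<bullet> sgn (g (T x) - z) \<le> 1 - 2 * k"
    and "0 \<le> k" "k \<le> 1"
  shows "sqrt k \<le> ratio g T z x"
proof (cases "g x = z \<or> g (T x) = z")
  case True
  thus ?thesis using ratio_center[of g x z T] assms by simp
next
  case False
  hence "sqrt k * (cmod (g x - z) + cmod (g (T x) - z)) \<le> cmod (g x - g (T x))"
    using assms by (intro dist_ge_if_angle_large) auto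
  moreover have "cmod (g x - z) + cmod (g (T x) - z) > 0" using False by (simp add: add_pos_pos)
  ultimately show ?thesis unfolding ratio_def by (simp add: le_divide_eq)
qed

section \<open>Bounds for essential infima, suprema and infima\<close>

context
  fixes M :: "'a measure"
  assumes nontriv: "emeasure M (space M) \<noteq> 0"
begin

text \<open>The space is not a null set, so the two inequalities hold jointly at some point. This
  provides the boundedness without which \<open>Sup\<close> and \<open>Inf\<close> of reals carry no
  information.\<close>

lemma const_le_if_AE:
  assumes "AE x in M. c \<le> f x" "AE x in M. f x \<le> (b::real)"
  shows "c \<le> b"
proof (rule ccontr)
  assume "\<not> c \<le> b"
  have "AE x in M. False" using assms by eventually_elim (use \<open>\<not> c \<le> b\<close> in auto)
  thus False using nontriv by (simp add: AE_iff_null null_setsD1)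
qed

lemma ess_inf_ge: "AE x in M. c \<le> f x \<Longrightarrow> AE x in M. f x \<le> b \<Longrightarrow> c \<le> ess_inf M f"
  unfolding ess_inf_def by (intro cSup_upper bdd_aboveI[of _ b]) (auto intro: const_le_if_AE)

lemma ess_inf_le:
  assumes "\<And>c. AE x in M. c \<le> f x \<Longrightarrow> c \<le> b" "AE x in M. a \<le> f x"
  shows "ess_inf M f \<le> b"
  unfolding ess_inf_def using assms by (intro cSup_least) auto

lemma Lam_ge: "AE x in M. c \<le> ratio g T z x \<Longrightarrow> c \<le> Lam M g T z"
  unfolding Lam_def by (rule ess_inf_ge[where b = 1]) (auto simp: ratio_le_1)

lemma Lam_le: "(\<And>c. AE x in M. c \<le> ratio g T z x \<Longrightarrow> c \<le> b) \<Longrightarrow> Lam M g T z \<le> b"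
  unfolding Lam_def by (rule ess_inf_le[where a = 0]) (auto simp: ratio_nonneg)

lemma Lam_le_1: "Lam M g T z \<le> 1"
  using const_le_if_AE[where b = 1 and f = "ratio g T z"] by (intro Lam_le) (auto simp: ratio_le_1)

lemma Lam_nonneg: "0 \<le> Lam M g T z"
  by (intro Lam_ge) (auto simp: ratio_nonneg)

lemma id_in_Aut: "id \<in> Aut M"
  unfolding Aut_def by (auto intro!: exI[of _ "space M"] simp: Int_absorb2 sets.sets_into_space)

lemma Lam_le_LamSup: "T \<in> Aut M \<Longrightarrow> Lam M g T z \<le> LamSup M g"
  unfolding LamSup_def by (intro cSup_upper bdd_aboveI[of _ 1]) (auto intro: Lam_le_1)

lemma LamSup_le: "(\<And>T z. T \<in> Aut M \<Longrightarrow> Lam M g T z \<le> b) \<Longrightarrow> LamSup M g \<le> b"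
  unfolding LamSup_def using id_in_Aut by (intro cSup_least) auto

lemma LamSup_nonneg: "0 \<le> LamSup M g"
  using Lam_nonneg[of g id 0] Lam_le_LamSup[OF id_in_Aut, of g 0] by linarith

lemma LamInf_le: "g \<in> borel_measurable M \<Longrightarrow> LamInf M \<le> LamSup M g"
  unfolding LamInf_def by (intro cInf_lower bdd_belowI[of _ 0]) (auto intro: LamSup_nonneg)

lemma LamInf_ge: "(\<And>g. g \<in> borel_measurable M \<Longrightarrow> b \<le> LamSup M g) \<Longrightarrow> b \<le> LamInf M"
  unfolding LamInf_def by (intro cInf_greatest) (use borel_measurable_const in blast)+

lemma LamInf_le_1: "LamInf M \<le> 1"
  using LamInf_le[of "\<lambda>_. 0"] LamSup_le[of "\<lambda>_. 0" 1] Lam_le_1 by fastforce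

text \<open>\<open>LamSup\<close> is a supremum, so angles arbitrarily close to 120 degrees suffice,
  with \<open>T\<close> and \<open>z\<close> depending on the error; the bound 3/4 is the squared
  sine of 60 degrees.\<close>

lemma LamSup_ge_if_angles_large:
  assumes "\<And>k. 0 < k \<Longrightarrow> k < 3 / 4 \<Longrightarrow> \<exists>T\<in>Aut M. \<exists>z. AE x in M. g x \<noteq> z \<longrightarrow> g (T x) \<noteq> z \<longrightarrow>
      sgn (g x - z) \<bullet> sgn (g (T x) - z) \<le> 1 - 2 * k"
  shows "sqrt 3 / 2 \<le> LamSup M g"
proof (rule dense_le_bounded[of 0])
  fix c :: real assume c: "0 < c" "c < sqrt 3 / 2"
  have "c\<^sup>2 < (sqrt 3 / 2)\<^sup>2" using c by (intro power_strict_mono) auto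
  hence k: "0 < c\<^sup>2" "c\<^sup>2 < 3 / 4" using c by (auto simp: power_divide)
  obtain T z where T: "T \<in> Aut M" and ae: "AE x in M. g x \<noteq> z \<longrightarrow> g (T x) \<noteq> z \<longrightarrow>
      sgn (g x - z) \<bullet> sgn (g (T x) - z) \<le> 1 - 2 * c\<^sup>2"
    using assms[OF k] by auto
  have "AE x in M. c \<le> ratio g T z x"
    using ae
  proof eventually_elim
    case (elim x)
    have "sqrt (c\<^sup>2) \<le> ratio g T z x" using elim k by (intro ratio_ge_if_angle_large) auto
    thus ?case using c by simp
  qed
  thus "c \<le> LamSup M g" using Lam_ge Lam_le_LamSup[OF T] by (meson order_trans)
qed simp

end

subsection \<open>Half turns of finite sets\<close>

text \<open>\<open>Arg2pi\<close> jumps across the positive real axis, but its strict upper level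
  sets are open.\<close>

lemma borel_measurable_Arg2pi [measurable]: "Arg2pi \<in> borel_measurable borel"
  by (rule borel_measurable_iff_greater[THEN iffD2]) (simp add: borel_open open_Arg2pi2pi_gt)

text \<open>The index of the arc \<open>[2 \<pi> j / K, 2 \<pi> (j + 1) / K)\<close> of directions that contains \<open>y\<close>.\<close>

definition slot :: "nat \<Rightarrow> complex \<Rightarrow> nat" where
  "slot K y = nat \<lfloor>real K * Arg2pi y / (2 * pi)\<rfloor>"

lemma slot_measurable [measurable]: "slot K \<in> measurable borel (count_space UNIV)"
  unfolding slot_def by measurable

lemma slot_bounds:
  assumes "K > 0"
  shows "2 * pi * real (slot K y) / real K \<le> Arg2pi y"
    and "Arg2pi y < 2 * pi * (real (slot K y) + 1) / real K" and "slot K y < K"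
proof -
  define q where "q = real K * Arg2pi y / (2 * pi)"
  have q: "0 \<le> q" "q < real K"
    using Arg2pi[of y] assms by (auto simp: q_def field_simps)
  have s: "real (slot K y) = of_int \<lfloor>q\<rfloor>" using q by (simp add: slot_def q_def)
  have 1: "real (slot K y) \<le> q" "q < real (slot K y) + 1" unfolding s by linarith+
  have "Arg2pi y = 2 * pi * q / real K" using assms by (simp add: q_def)
  moreover have "2 * pi * real (slot K y) \<le> 2 * pi * q" "2 * pi * q < 2 * pi * (real (slot K y) + 1)"
    using 1 by (auto intro!: mult_left_mono mult_strict_left_mono)
  ultimately show "2 * pi * real (slot K y) / real K \<le> Arg2pi y"
    and "Arg2pi y < 2 * pi * (real (slot K y) + 1) / real K"
    using assms by (auto intro!: divide_right_mono divide_strict_right_mono)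
  show "slot K y < K" using 1 q by linarith
qed

lemma cis_Arg2pi_unit: "norm y = 1 \<Longrightarrow> cis (Arg2pi y) = y"
  using complex_norm_eq_1_exp[of y] by (simp add: cis_conv_exp)

lemma inner_cis: "cis a \<bullet> cis b = cos (a - b)"
  by (simp add: inner_complex_def cos_diff)

context finite_measure
begin

text \<open>An arc shorter than 120 degrees lies in the open cone around its midpoint and so carries
  at most half of the mass. The arc is given by real angles, not by values of \<open>Arg2pi\<close>,
  so that it may cross the positive real axis.\<close>

lemma balanced_arc_long:
  assumes bal: "\<And>d. norm d = 1 \<Longrightarrow> measure M {x \<in> space M. u x \<in> sector d} \<le> measure M (space M) / 2"
    and [measurable]: "u \<in> borel_measurable M" and E: "E \<subseteq> space M" "measure M E > measure M (space M) / 2"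
    and arc: "\<And>x. x \<in> E \<Longrightarrow> \<exists>t. u x = cis t \<and> \<alpha> \<le> t \<and> t \<le> \<beta>"
  shows "\<beta> - \<alpha> \<ge> 2 * pi / 3"
proof (rule ccontr)
  assume less: "\<not> \<beta> - \<alpha> \<ge> 2 * pi / 3"
  define d where "d = cis ((\<alpha> + \<beta>) / 2)"
  have "u x \<in> sector d" if x: "x \<in> E" for x
  proof -
    obtain t where t: "u x = cis t" "\<alpha> \<le> t" "t \<le> \<beta>" using arc[OF x] by auto
    have "\<bar>t - (\<alpha> + \<beta>) / 2\<bar> < pi / 3" using t less by (simp add: abs_if field_simps)
    hence "cos (pi / 3) < cos \<bar>t - (\<alpha> + \<beta>) / 2\<bar>"
      by (intro cos_monotone_0_pi) (auto simp: field_simps)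
    hence "1 / 2 < cos (t - (\<alpha> + \<beta>) / 2)" by (simp add: cos_60)
    thus ?thesis unfolding t(1) d_def by (simp add: sector_def inner_cis)
  qed
  hence "E \<subseteq> {x \<in> space M. u x \<in> sector d}" using E by auto
  hence "measure M E \<le> measure M {x \<in> space M. u x \<in> sector d}" by (intro finite_measure_mono) auto
  thus False using bal[of d] E by (simp add: d_def)
qed

text \<open>Both arcs between the slots of \<open>a\<close> and \<open>b\<close>, end slots
  included, carry more than half of the mass and so span at least 120 degrees; on the arc through
  angle 0 the small angles are lifted by 2 pi. End slots and rounding cost at most two slot widths,
  that is \<open>4 * pi / K\<close>.\<close>

lemma slots_far_apart:
  assumes bal: "\<And>d. norm d = 1 \<Longrightarrow> measure M {x \<in> space M. u x \<in> sector d} \<le> measure M (space M) / 2"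
    and [measurable]: "u \<in> borel_measurable M" and unit: "\<And>x. x \<in> space M \<Longrightarrow> norm (u x) = 1"
    and K: "K \<ge> 6" and ab: "norm a = 1" "norm b = 1" "slot K a \<le> slot K b"
    and E: "measure M {x \<in> space M. slot K a \<le> slot K (u x) \<and> slot K (u x) \<le> slot K b} > measure M (space M) / 2"
    and F: "measure M {x \<in> space M. slot K b \<le> slot K (u x) \<or> slot K (u x) \<le> slot K a} > measure M (space M) / 2"
  shows "a \<bullet> b \<le> - cos (pi / 3 + 4 * pi / real K)"
proof -
  define i where "i = slot K a"
  define j where "j = slot K b"
  define q where "q = 2 * pi / real K"
  have "K > 0" using K by simp
  have qpos: "q > 0" using \<open>K > 0\<close> by (simp add: q_def)
  have qK: "q * real K = 2 * pi" using \<open>K > 0\<close> by (simp add: q_def)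
  have sb: "q * real (slot K y) \<le> Arg2pi y" "Arg2pi y < q * (real (slot K y) + 1)" for y
    using slot_bounds[OF \<open>K > 0\<close>, of y] by (auto simp: q_def)
  have "q * (real j + 1) - q * real i \<ge> 2 * pi / 3"
  proof (rule balanced_arc_long[OF bal _ _ E])
    fix x assume x: "x \<in> {x \<in> space M. slot K a \<le> slot K (u x) \<and> slot K (u x) \<le> slot K b}"
    have "q * real i \<le> q * real (slot K (u x))" "q * (real (slot K (u x)) + 1) \<le> q * (real j + 1)"
      using x qpos by (auto simp: i_def j_def)
    thus "\<exists>t. u x = cis t \<and> q * real i \<le> t \<and> t \<le> q * (real j + 1)"
      using sb[of "u x"] cis_Arg2pi_unit[of "u x"] unit x by (intro exI[of _ "Arg2pi (u x)"]) auto
  qed auto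
  moreover have "(2 * pi + q * (real i + 1)) - q * real j \<ge> 2 * pi / 3"
  proof (rule balanced_arc_long[OF bal _ _ F])
    fix x assume x: "x \<in> {x \<in> space M. slot K b \<le> slot K (u x) \<or> slot K (u x) \<le> slot K a}"
    hence u: "u x = cis (Arg2pi (u x))" "u x = cis (Arg2pi (u x) + 2 * pi)"
      using cis_Arg2pi_unit[of "u x"] unit x by (auto simp: cis_mult[symmetric])
    have r: "0 \<le> Arg2pi (u x)" "Arg2pi (u x) < 2 * pi" using Arg2pi[of "u x"] by auto
    have jK: "q * real j \<le> 2 * pi" using sb(1)[of b] Arg2pi[of b] by (simp add: j_def)
    have ipos: "q * (real i + 1) \<ge> 0" using qpos by simp
    from x show "\<exists>t. u x = cis t \<and> q * real j \<le> t \<and> t \<le> 2 * pi + q * (real i + 1)"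
    proof (elim CollectE conjE disjE)
      assume "slot K b \<le> slot K (u x)"
      hence "q * real j \<le> q * real (slot K (u x))" using qpos by (simp add: j_def)
      thus ?thesis using sb[of "u x"] u r ipos by (intro exI[of _ "Arg2pi (u x)"]) linarith
    next
      assume "slot K (u x) \<le> slot K a"
      hence "q * (real (slot K (u x)) + 1) \<le> q * (real i + 1)" using qpos by (simp add: i_def)
      thus ?thesis using sb[of "u x"] u r jK by (intro exI[of _ "Arg2pi (u x) + 2 * pi"]) linarith
    qed
  qed auto
  ultimately have arcs: "q * real j - q * real i \<ge> 2 * pi / 3 - q" "q * real j - q * real i \<le> 4 * pi / 3 + q"
    by (auto simp: algebra_simps)
  \<comment> \<open>The deviation of \<open>b\<close> from the antipode of \<open>a\<close>. The
    condition \<open>K \<ge> 6\<close> keeps its bound within [0, pi], where the cosine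
    decreases.\<close>
  define w where "w = Arg2pi b - Arg2pi a - pi"
  have "\<bar>w\<bar> \<le> pi / 3 + 2 * q"
    using arcs sb[of a] sb[of b] unfolding w_def i_def j_def by (simp add: algebra_simps abs_if)
  moreover have "pi / 3 + 2 * q \<le> pi" using K \<open>K > 0\<close> by (simp add: q_def field_simps)
  ultimately have "cos (pi / 3 + 2 * q) \<le> cos \<bar>w\<bar>" by (intro cos_monotone_0_pi_le) auto
  moreover have "cos \<bar>w\<bar> = - cos (Arg2pi b - Arg2pi a)" by (simp add: w_def)
  moreover have "a \<bullet> b = cos (Arg2pi b - Arg2pi a)"
    using inner_cis[of "Arg2pi b" "Arg2pi a"] ab by (simp add: cis_Arg2pi_unit inner_commute)
  ultimately show ?thesis by (simp add: q_def)
qed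

end

lemma eventually_slots_fine:
  assumes "k < 3 / 4"
  shows "\<exists>K\<ge>6. - cos (pi / 3 + 4 * pi / real K) \<le> 1 - 2 * k"
proof -
  have "(\<lambda>K. - cos (pi / 3 + 4 * pi / real K)) \<longlonglongrightarrow> - cos (pi / 3 + 0)"
    by (intro tendsto_intros real_tendsto_divide_at_top filterlim_real_sequentially)
  hence "\<forall>\<^sub>F K in sequentially. - cos (pi / 3 + 4 * pi / real K) < 1 - 2 * k"
    using assms by (intro order_tendstoD) (auto simp: cos_60)
  hence "\<forall>\<^sub>F K in sequentially. K \<ge> 6 \<and> - cos (pi / 3 + 4 * pi / real K) < 1 - 2 * k"
    using eventually_ge_at_top[of 6] by eventually_elim auto
  thus ?thesis using eventually_happens'[OF sequentially_bot] less_imp_le by blast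
qed

section \<open>Half turns by sorting\<close>

lemma exists_sorted_enumeration:
  fixes f :: "'a \<Rightarrow> nat"
  assumes "finite X"
  shows "\<exists>e. bij_betw e {..<card X} X \<and> (\<forall>a b. a \<le> b \<longrightarrow> b < card X \<longrightarrow> f (e a) \<le> f (e b))"
proof -
  obtain ys where ys: "set ys = X" "distinct ys" using finite_distinct_list[OF assms] by auto
  define xs where "xs = sort_key f ys"
  have xs: "set xs = X" "distinct xs" "sorted (map f xs)" using ys by (auto simp: xs_def)
  have len: "length xs = card X" using distinct_card[OF xs(2)] xs(1) by simp
  have "bij_betw ((!) xs) {..<card X} X" using xs len by (intro bij_betw_nth) auto
  moreover have "f (xs ! a) \<le> f (xs ! b)" if "a \<le> b" "b < card X" for a b
    using sorted_nth_mono[OF xs(3), of a b] that len by simp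
  ultimately show ?thesis by blast
qed

lemma bij_betw_rotate:
  assumes "p < N"
  shows "bij_betw (\<lambda>a::nat. (a + p) mod N) {..<N} {..<N}"
proof -
  have "(a + p) mod N = (if a + p < N then a + p else a + p - N)" if "a < N" for a
    using that assms by (simp add: mod_if)
  hence "inj_on (\<lambda>a::nat. (a + p) mod N) {..<N}"
    using assms by (intro inj_onI) (auto split: if_splits)
  moreover have "(\<lambda>a::nat. (a + p) mod N) ` {..<N} \<subseteq> {..<N}" using assms by auto
  ultimately show ?thesis by (simp add: bij_betw_def endo_inj_surj)
qed

text \<open>The points are sorted by slot and advanced cyclically by \<open>N div 2\<close> places.
  Both arcs between a point and its image contain their end points, which makes each of them contain
  more than half of the points even for odd \<open>N\<close>.\<close>

lemma finite_half_turn: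
  fixes X :: "'a set" and u :: "'a \<Rightarrow> complex"
  assumes fin: "finite X" and unit: "\<And>x. x \<in> X \<Longrightarrow> norm (u x) = 1"
    and bal: "\<And>d. norm d = 1 \<Longrightarrow> real (card {x \<in> X. u x \<in> sector d}) \<le> real (card X) / 2"
    and K: "K \<ge> 6"
  shows "\<exists>T. bij_betw T X X \<and> (\<forall>x\<in>X. u x \<bullet> u (T x) \<le> - cos (pi / 3 + 4 * pi / real K))"
proof (cases "X = {}")
  case True
  thus ?thesis by auto
next
  case False
  define N where "N = card X"
  have "N > 0" using False fin by (simp add: N_def card_gt_0_iff)
  interpret C: finite_measure "count_space X" using fin by (rule finite_measure_count_space)
  have mC: "measure (count_space X) A = real (card A)" if "A \<subseteq> X" for A
    using that fin by (simp add: measure_count_space finite_subset)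
  obtain e where e: "bij_betw e {..<N} X" and mono: "\<And>a b. a \<le> b \<Longrightarrow> b < N \<Longrightarrow> slot K (u (e a)) \<le> slot K (u (e b))"
    using exists_sorted_enumeration[OF fin, of "\<lambda>x. slot K (u x)"] unfolding N_def by blast
  have eX: "e a \<in> X" if "a < N" for a using e that by (auto simp: bij_betw_def)
  have ecard: "card (e ` A) = card A" if "A \<subseteq> {..<N}" for A
    using e that by (meson bij_betw_def card_image inj_on_subset)
  \<comment> \<open>The inner arc contains at least \<open>c + 1\<close> points and the outer one at
    least \<open>N - c + 1\<close>, or all \<open>N\<close> if \<open>c = 0\<close>; the two
    conditions on \<open>c\<close> say that these numbers exceed \<open>N / 2\<close>. They hold for
    \<open>c = N div 2\<close> and for \<open>c = N - N div 2\<close>, the distance after wrapping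
    around.\<close>
  have key: "u (e a) \<bullet> u (e b) \<le> - cos (pi / 3 + 4 * pi / real K)"
    if b: "b = a + c" "b < N" and far: "N < 2 * c + 2" "2 * c < N + 2" for a b c
  proof (rule C.slots_far_apart)
    fix d :: complex assume "norm d = 1"
    thus "measure (count_space X) {x \<in> space (count_space X). u x \<in> sector d}
        \<le> measure (count_space X) (space (count_space X)) / 2"
      using bal[of d] by (simp add: mC)
  next
    have ab: "a \<le> b" "b < N" using b by auto
    let ?E = "{x \<in> X. slot K (u (e a)) \<le> slot K (u x) \<and> slot K (u x) \<le> slot K (u (e b))}"
    have "e ` {a..b} \<subseteq> ?E" using ab mono eX by auto
    hence "card (e ` {a..b}) \<le> card ?E" using fin by (intro card_mono) auto
    hence "card {a..b} \<le> card ?E" using ecard[of "{a..b}"] ab by (simp add: subset_iff)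
    hence "c + 1 \<le> card ?E" using b by simp
    hence "2 * card ?E > N" using far(1) by linarith
    hence "real (card ?E) > real N / 2" by linarith
    thus "measure (count_space X) {x \<in> space (count_space X). slot K (u (e a)) \<le> slot K (u x) \<and> slot K (u x) \<le> slot K (u (e b))}
        > measure (count_space X) (space (count_space X)) / 2"
      by (simp add: mC N_def)
  next
    have ab: "a \<le> b" "b < N" using b by auto
    let ?F = "{x \<in> X. slot K (u (e b)) \<le> slot K (u x) \<or> slot K (u x) \<le> slot K (u (e a))}"
    have "e ` ({..a} \<union> {b..<N}) \<subseteq> ?F" using ab mono eX by auto
    hence "card (e ` ({..a} \<union> {b..<N})) \<le> card ?F" using fin by (intro card_mono) auto
    hence "card ({..a} \<union> {b..<N}) \<le> card ?F" using ecard[of "{..a} \<union> {b..<N}"] ab by (simp add: subset_iff)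
    moreover have "2 * card ({..a} \<union> {b..<N}) > N"
    proof (cases "a = b")
      case True
      hence "{..a} \<union> {b..<N} = {..<N}" using ab by auto
      thus ?thesis using \<open>N > 0\<close> by simp
    next
      case False
      hence "card ({..a} \<union> {b..<N}) = a + 1 + (N - b)" using ab by (subst card_Un_disjoint) auto
      thus ?thesis using far(2) b by simp
    qed
    ultimately have "2 * card ?F > N" by linarith
    hence "real (card ?F) > real N / 2" by linarith
    thus "measure (count_space X) {x \<in> space (count_space X). slot K (u (e b)) \<le> slot K (u x) \<or> slot K (u x) \<le> slot K (u (e a))}
        > measure (count_space X) (space (count_space X)) / 2"
      by (simp add: mC N_def)
  next
    have ab: "a \<le> b" "b < N" using b by auto
    show "norm (u (e a)) = 1" "norm (u (e b)) = 1" using unit eX ab by auto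
    show "slot K (u (e a)) \<le> slot K (u (e b))" using mono ab by blast
  qed (use K unit in auto)
  define p where "p = N div 2"
  define R where "R = (\<lambda>a. (a + p) mod N)"
  have R: "bij_betw R {..<N} {..<N}" unfolding R_def using \<open>N > 0\<close> by (intro bij_betw_rotate) (simp add: p_def)
  define T where "T = e \<circ> R \<circ> the_inv_into {..<N} e"
  have "bij_betw T X X"
    unfolding T_def by (intro bij_betw_trans[OF bij_betw_the_inv_into[OF e]] bij_betw_trans[OF R] e)
  moreover have "u x \<bullet> u (T x) \<le> - cos (pi / 3 + 4 * pi / real K)" if "x \<in> X" for x
  proof -
    obtain a where a: "a < N" "x = e a" using e \<open>x \<in> X\<close> by (auto simp: bij_betw_def)
    have Tx: "T x = e (R a)" using a e by (simp add: T_def bij_betw_def the_inv_into_f_f)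
    show ?thesis
    proof (cases "a + p < N")
      case True
      hence "R a = a + p" by (simp add: R_def)
      moreover have "u (e a) \<bullet> u (e (a + p)) \<le> - cos (pi / 3 + 4 * pi / real K)"
        using True by (intro key[where c = p]) (auto simp: p_def)
      ultimately show ?thesis using Tx a(2) by simp
    next
      case False
      hence "R a = a + p - N" using a by (simp add: R_def p_def mod_if)
      moreover have "u (e (a + p - N)) \<bullet> u (e a) \<le> - cos (pi / 3 + 4 * pi / real K)"
        using False a \<open>N > 0\<close> by (intro key[where c = "N - p"]) (auto simp: p_def)
      ultimately show ?thesis using Tx a(2) by (simp add: inner_commute)
    qed
  qed
  ultimately show ?thesis by blast
qed

text \<open>Balanced directions may require a set of points at \<open>z\<close> with exactly
  \<open>card X / 2 - p\<close> elements. The supremum \<open>p\<close> is attained, hence a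
  cardinality, so this number is an integer when \<open>card X\<close> is even; when it is odd, no
  point lies at \<open>z\<close> and nothing has to be split.\<close>

lemma finite_exists_turn:
  fixes X :: "'a set" and g :: "'a \<Rightarrow> complex"
  assumes fin: "finite X" and par: "even (card X) \<or> (\<forall>x\<in>X. g x \<noteq> z)"
    and bal: "\<And>d. norm d = 1 \<Longrightarrow> real (card {x \<in> X. g x - z \<in> sector d}) \<le> real (card X) / 2"
    and K: "K \<ge> 6"
  shows "\<exists>T. bij_betw T X X \<and> (\<forall>x\<in>X. g x \<noteq> z \<longrightarrow> g (T x) \<noteq> z \<longrightarrow>
     sgn (g x - z) \<bullet> sgn (g (T x) - z) \<le> - cos (pi / 3 + 4 * pi / real K))"
proof -
  interpret C: finite_measure "count_space X" using fin by (rule finite_measure_count_space)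
  have mC: "measure (count_space X) A = real (card A)" if "A \<subseteq> X" for A
    using that fin by (simp add: measure_count_space finite_subset)
  define h where "h = (\<lambda>d. card {x \<in> X. g x - z \<in> sector d})"
  have "\<exists>u \<in> borel_measurable (count_space X). (\<forall>x\<in>space (count_space X). norm (u x) = 1 \<and> (g x \<noteq> z \<longrightarrow> u x = sgn (g x - z))) \<and>
    (\<forall>d. norm d = 1 \<longrightarrow> measure (count_space X) {x \<in> space (count_space X). u x \<in> sector d} \<le> measure (count_space X) (space (count_space X)) / 2)"
  proof (rule C.exists_balanced_directions)
    assume "measure (count_space X) {x \<in> space (count_space X). g x = z} >
        measure (count_space X) (space (count_space X)) / 2 - (SUP d\<in>sphere 0 1. measure (count_space X) {x \<in> space (count_space X). g x - z \<in> sector d})"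
    hence lt: "real (card {x \<in> X. g x = z}) > real (card X) / 2 - (SUP d\<in>sphere 0 1. real (h d))"
      by (simp add: mC h_def)
    have "h d \<le> card X" for d unfolding h_def using fin by (intro card_mono) auto
    hence "h ` sphere 0 1 \<subseteq> {..card X}" by auto
    hence "finite ((\<lambda>d. real (h d)) ` sphere 0 1)" by (metis finite_atMost finite_imageI finite_subset image_image)
    moreover have "(\<lambda>d. real (h d)) ` sphere (0::complex) 1 \<noteq> {}" by simp
    ultimately have "Sup ((\<lambda>d. real (h d)) ` sphere (0::complex) 1) \<in> (\<lambda>d. real (h d)) ` sphere 0 1"
      by (metis Max_in cSup_eq_Max)
    then obtain d where d: "norm d = 1" "(SUP d\<in>sphere 0 1. real (h d)) = real (h d)" by auto
    have hd: "real (h d) \<le> real (card X) / 2" using bal[OF d(1)] by (simp add: h_def)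
    have "\<exists>C1 \<subseteq> {x \<in> X. g x = z}. real (card C1) = real (card X) / 2 - real (h d)"
    proof (cases "even (card X)")
      case True
      then obtain m where m: "card X = 2 * m" by auto
      have "m - h d \<le> card {x \<in> X. g x = z}" using lt hd unfolding d m by simp
      then obtain C1 where "C1 \<subseteq> {x \<in> X. g x = z}" "card C1 = m - h d"
        by (meson obtain_subset_with_card_n)
      thus ?thesis using hd m by (intro exI[of _ C1]) auto
    next
      case False
      hence "{x \<in> X. g x = z} = {}" using par by auto
      hence "card {x \<in> X. g x = z} = 0" by (simp only: card.empty)
      thus ?thesis using lt hd d by simp
    qed
    thus "\<exists>C\<in>sets (count_space X). C \<subseteq> {x \<in> space (count_space X). g x = z} \<and> measure (count_space X) C =
        measure (count_space X) (space (count_space X)) / 2 - (SUP d\<in>sphere 0 1. measure (count_space X) {x \<in> space (count_space X). g x - z \<in> sector d})"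
      using d(2) unfolding h_def
      by (elim exE conjE) (rule_tac x = C1 in bexI; auto simp: mC subset_iff)
  qed (use bal in \<open>auto simp: mC\<close>)
  then obtain u where u: "\<And>x. x \<in> X \<Longrightarrow> norm (u x) = 1" "\<And>x. x \<in> X \<Longrightarrow> g x \<noteq> z \<Longrightarrow> u x = sgn (g x - z)"
    and ubal: "\<And>d. norm d = 1 \<Longrightarrow> real (card {x \<in> X. u x \<in> sector d}) \<le> real (card X) / 2"
    by (auto simp: mC)
  obtain T where T: "bij_betw T X X" "\<And>x. x \<in> X \<Longrightarrow> u x \<bullet> u (T x) \<le> - cos (pi / 3 + 4 * pi / real K)"
    using finite_half_turn[OF fin u(1) ubal K] by auto
  have "T x \<in> X" if "x \<in> X" for x using T(1) that by (auto simp: bij_betw_def)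
  thus ?thesis using T u(2) by (intro exI[of _ T]) (metis (no_types, lifting))
qed

section \<open>The lower bound on finite spaces\<close>

lemma space_Omega_fin [simp]: "space (Omega_fin n) = {1..n}"
  by (simp add: Omega_fin_def space_uniform_count_measure)

lemma sets_Omega_fin [simp]: "sets (Omega_fin n) = Pow {1..n}"
  by (simp add: Omega_fin_def sets_uniform_count_measure)

lemma emeasure_Omega_fin: "A \<subseteq> {1..n} \<Longrightarrow> emeasure (Omega_fin n) A = ennreal (card A / n)"
  by (simp add: Omega_fin_def emeasure_uniform_count_measure)

lemma nontriv_Omega_fin: "n \<ge> 1 \<Longrightarrow> emeasure (Omega_fin n) (space (Omega_fin n)) \<noteq> 0"
  by (simp add: emeasure_Omega_fin)

lemma permutation_in_Aut_Omega_fin: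
  assumes T: "bij_betw T {1..n} {1..n}"
  shows "T \<in> Aut (Omega_fin n)"
proof -
  have inj: "inj_on T {1..n}" and im: "T ` {1..n} = {1..n}" using T by (auto simp: bij_betw_def)
  have "card (T -` S \<inter> {1..n}) = card S" if S: "S \<subseteq> {1..n}" for S
  proof -
    have "S \<subseteq> T ` {1..n}" using im S by simp
    hence "T ` (T -` S \<inter> {1..n}) = S" by fast
    moreover have "inj_on T (T -` S \<inter> {1..n})" using inj by (rule inj_on_subset) simp
    ultimately show ?thesis using card_image by fastforce
  qed
  hence meas: "emeasure (Omega_fin n) (T -` S \<inter> {1..n}) = emeasure (Omega_fin n) S" if "S \<subseteq> {1..n}" for S
    using that by (simp add: emeasure_Omega_fin)
  show ?thesis unfolding Aut_def mem_Collect_eq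
  proof (rule exI[of _ "{1..n}"], rule exI[of _ "{1..n}"], intro conjI ballI impI)
    fix S assume "S \<subseteq> {1..n}"
    thus "T ` S \<in> sets (Omega_fin n)" using im by (metis PowI image_mono sets_Omega_fin)
  qed (use T meas in auto)
qed

lemma LamSup_Omega_fin_ge:
  assumes "n \<ge> 1"
  shows "sqrt 3 / 2 \<le> LamSup (Omega_fin n) g"
proof (rule LamSup_ge_if_angles_large[OF nontriv_Omega_fin[OF assms]])
  fix k :: real assume k: "0 < k" "k < 3 / 4"
  then obtain K where K: "K \<ge> 6" "- cos (pi / 3 + 4 * pi / real K) \<le> 1 - 2 * k"
    using eventually_slots_fine by blast
  let ?X = "{1..n}"
  interpret C: finite_measure "count_space ?X" by (rule finite_measure_count_space) simp
  obtain z where z: "\<And>d. norm d = 1 \<Longrightarrow> real (card {x \<in> ?X. g x - z \<in> sector d}) \<le> real n / 2"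
  proof -
    obtain z where "\<And>d. norm d = 1 \<Longrightarrow> measure (count_space ?X) {x \<in> ?X. g x - z \<in> sector d} \<le> measure (count_space ?X) ?X / 2"
      using C.exists_balanced_apex[of g] by (auto simp del: One_nat_def)
    moreover have "measure (count_space ?X) {x \<in> ?X. g x - z \<in> sector d} = real (card {x \<in> ?X. g x - z \<in> sector d})" for d
      by (subst measure_count_space) auto
    ultimately show thesis using that[of z] by (simp add: measure_count_space)
  qed
  have "\<exists>T. bij_betw T ?X ?X \<and> (\<forall>x\<in>?X. g x \<noteq> z \<longrightarrow> g (T x) \<noteq> z \<longrightarrow>
     sgn (g x - z) \<bullet> sgn (g (T x) - z) \<le> - cos (pi / 3 + 4 * pi / real K))"
  proof (cases "even n \<or> (\<forall>x\<in>?X. g x \<noteq> z)")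
    case True
    thus ?thesis using z K by (intro finite_exists_turn) auto
  next
    case False
    then obtain c where c: "c \<in> ?X" "g c = z" and "odd n" by auto
    \<comment> \<open>A single point at \<open>z\<close> is removed and later fixed by
      \<open>T'\<close>. Cones do not contain their apex, so their counts are unchanged, and for odd
      \<open>n\<close> an even number that is at most \<open>n\<close> is at most
      \<open>n - 1\<close>: the remaining set of even size is still balanced.\<close>
    define Y where "Y = ?X - {c}"
    have cY: "card Y = n - 1" using c by (simp add: Y_def)
    have "\<exists>T. bij_betw T Y Y \<and> (\<forall>x\<in>Y. g x \<noteq> z \<longrightarrow> g (T x) \<noteq> z \<longrightarrow>
      sgn (g x - z) \<bullet> sgn (g (T x) - z) \<le> - cos (pi / 3 + 4 * pi / real K))"
    proof (rule finite_exists_turn)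
      fix d :: complex assume d: "norm d = 1"
      have "{x \<in> Y. g x - z \<in> sector d} = {x \<in> ?X. g x - z \<in> sector d}"
        using c by (auto simp: Y_def sector_def)
      hence "2 * card {x \<in> Y. g x - z \<in> sector d} \<le> n" using z[OF d] by simp
      hence "2 * card {x \<in> Y. g x - z \<in> sector d} \<le> n - 1" using \<open>odd n\<close> by presburger
      thus "real (card {x \<in> Y. g x - z \<in> sector d}) \<le> real (card Y) / 2" unfolding cY by linarith
    qed (use K cY \<open>odd n\<close> in \<open>auto simp: Y_def\<close>)
    then obtain T where T: "bij_betw T Y Y" "\<And>x. x \<in> Y \<Longrightarrow> g x \<noteq> z \<Longrightarrow> g (T x) \<noteq> z \<Longrightarrow>
      sgn (g x - z) \<bullet> sgn (g (T x) - z) \<le> - cos (pi / 3 + 4 * pi / real K)" by blast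
    define T' where "T' = T(c := c)"
    have "bij_betw T' Y Y" using T(1) by (rule bij_betw_cong[THEN iffD1, rotated]) (auto simp: T'_def Y_def)
    hence "bij_betw T' (Y \<union> {c}) (Y \<union> {c})"
      by (rule bij_betw_combine) (auto simp: T'_def Y_def bij_betw_def)
    moreover have "Y \<union> {c} = ?X" using c by (auto simp: Y_def)
    ultimately show ?thesis using T(2) c by (intro exI[of _ T']) (auto simp: T'_def Y_def)
  qed
  then obtain T where "bij_betw T ?X ?X" "\<And>x. x \<in> ?X \<Longrightarrow> g x \<noteq> z \<Longrightarrow> g (T x) \<noteq> z \<Longrightarrow>
     sgn (g x - z) \<bullet> sgn (g (T x) - z) \<le> - cos (pi / 3 + 4 * pi / real K)" by blast
  moreover from this have "AE x in Omega_fin n. g x \<noteq> z \<longrightarrow> g (T x) \<noteq> z \<longrightarrow>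
      sgn (g x - z) \<bullet> sgn (g (T x) - z) \<le> 1 - 2 * k"
    using K(2) by (intro AE_I2 impI) (rule order_trans; simp)
  ultimately show "\<exists>T\<in>Aut (Omega_fin n). \<exists>z. AE x in Omega_fin n. g x \<noteq> z \<longrightarrow> g (T x) \<noteq> z \<longrightarrow>
      sgn (g x - z) \<bullet> sgn (g (T x) - z) \<le> 1 - 2 * k"
    using permutation_in_Aut_Omega_fin by blast
qed

subsection \<open>Automorphisms and three-valued functions\<close>

lemma AutE:
  assumes "T \<in> Aut M"
  obtains A B where "A \<in> sets M" "B \<in> sets M" "AE x in M. x \<in> A" "AE x in M. x \<in> B"
    "bij_betw T A B" "\<And>S. S \<in> sets M \<Longrightarrow> S \<subseteq> B \<Longrightarrow> T -` S \<inter> A \<in> sets M"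
    "\<And>S. S \<in> sets M \<Longrightarrow> S \<subseteq> B \<Longrightarrow> emeasure M (T -` S \<inter> A) = emeasure M S"
    "\<And>S. S \<in> sets M \<Longrightarrow> S \<subseteq> A \<Longrightarrow> T ` S \<in> sets M"
proof -
  obtain A B where *: "A \<in> sets M" "B \<in> sets M"
      "emeasure M (space M - A) = 0" "emeasure M (space M - B) = 0"
      "bij_betw T A B"
      "\<forall>S\<in>sets M. S \<subseteq> B \<longrightarrow> T -` S \<inter> A \<in> sets M \<and> emeasure M (T -` S \<inter> A) = emeasure M S"
      "\<forall>S\<in>sets M. S \<subseteq> A \<longrightarrow> T ` S \<in> sets M"
    using assms unfolding Aut_def by blast
  have "AE x in M. x \<in> A" by (rule AE_I[of _ _ "space M - A"]) (use * in auto)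
  moreover have "AE x in M. x \<in> B" by (rule AE_I[of _ _ "space M - B"]) (use * in auto)
  ultimately show thesis
    by (rule that[OF *(1,2) _ _ *(5)]) (use *(6,7) in auto)
qed

lemma AutI:
  assumes "A \<in> sets M" "B \<in> sets M" "AE x in M. x \<in> A" "AE x in M. x \<in> B"
    "bij_betw T A B" "\<And>S. S \<in> sets M \<Longrightarrow> S \<subseteq> B \<Longrightarrow> T -` S \<inter> A \<in> sets M"
    "\<And>S. S \<in> sets M \<Longrightarrow> S \<subseteq> B \<Longrightarrow> emeasure M (T -` S \<inter> A) = emeasure M S"
    "\<And>S. S \<in> sets M \<Longrightarrow> S \<subseteq> A \<Longrightarrow> T ` S \<in> sets M"
  shows "T \<in> Aut M"
proof -
  have "emeasure M (space M - C) = 0" if "AE x in M. x \<in> C" "C \<in> sets M" for C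
  proof -
    have "{x \<in> space M. x \<notin> C} \<in> null_sets M" using that by (subst AE_iff_null[symmetric]) auto
    moreover have "{x \<in> space M. x \<notin> C} = space M - C" by auto
    ultimately show ?thesis by (simp add: null_setsD1)
  qed
  hence "emeasure M (space M - A) = 0" "emeasure M (space M - B) = 0" using assms(1-4) by auto
  thus ?thesis unfolding Aut_def using assms(1,2,5-8)
    by (intro CollectI exI[of _ A] exI[of _ B] conjI ballI impI) simp_all
qed

text \<open>Exceptional null sets pull back to null sets.\<close>

lemma Aut_AE:
  assumes T: "T \<in> Aut M" and ae: "AE y in M. P y"
  shows "AE x in M. P (T x)"
proof -
  obtain A B where AB: "A \<in> sets M" "B \<in> sets M" "AE x in M. x \<in> A" "AE x in M. x \<in> B"
    "bij_betw T A B" "\<And>S. S \<in> sets M \<Longrightarrow> S \<subseteq> B \<Longrightarrow> T -` S \<inter> A \<in> sets M"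
    "\<And>S. S \<in> sets M \<Longrightarrow> S \<subseteq> B \<Longrightarrow> emeasure M (T -` S \<inter> A) = emeasure M S"
    using AutE[OF T] by metis
  obtain N where N: "{x \<in> space M. \<not> P x} \<subseteq> N" "emeasure M N = 0" "N \<in> sets M"
    using ae by (rule AE_E)
  have "emeasure M (N \<inter> B) = 0" using N AB(2) by (metis emeasure_eq_0 inf_le1)
  hence null: "emeasure M (T -` (N \<inter> B) \<inter> A) = 0" "T -` (N \<inter> B) \<inter> A \<in> sets M"
    using AB(6,7)[of "N \<inter> B"] AB(2) N by (simp_all del: vimage_Int)
  have "AE x in M. x \<notin> T -` (N \<inter> B) \<inter> A" using null by (intro AE_not_in) (auto simp: null_sets_def)
  thus ?thesis using AB(3)
  proof eventually_elim
    case (elim x)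
    hence "T x \<in> B" using AB(5) by (auto simp: bij_betw_def)
    hence "T x \<in> space M" "T x \<notin> N" using elim AB(2) sets.sets_into_space by auto
    thus ?case using N(1) by auto
  qed
qed

lemma Aut_AE_space: "T \<in> Aut M \<Longrightarrow> AE x in M. T x \<in> space M"
  by (rule Aut_AE) auto

text \<open>Almost all of \<open>S\<close> lies in the preimage of \<open>R\<close>, and preimages
  keep their measure. This turns a forced transition between level sets into an inequality of
  masses.\<close>

lemma Aut_emeasure_le:
  assumes T: "T \<in> Aut M" and S: "S \<in> sets M" and R: "R \<in> sets M" and ae: "AE x in M. x \<in> S \<longrightarrow> T x \<in> R"
  shows "emeasure M S \<le> emeasure M R"
proof -
  obtain A B where AB: "A \<in> sets M" "B \<in> sets M" "AE x in M. x \<in> A" "AE x in M. x \<in> B"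
    "bij_betw T A B" "\<And>S. S \<in> sets M \<Longrightarrow> S \<subseteq> B \<Longrightarrow> T -` S \<inter> A \<in> sets M"
    "\<And>S. S \<in> sets M \<Longrightarrow> S \<subseteq> B \<Longrightarrow> emeasure M (T -` S \<inter> A) = emeasure M S"
    using AutE[OF T] by metis
  have "AE x in M. x \<in> S \<longrightarrow> x \<in> T -` (R \<inter> B) \<inter> A"
    using ae AB(3) by eventually_elim (use AB(5) in \<open>auto simp: bij_betw_def\<close>)
  hence "emeasure M S \<le> emeasure M (T -` (R \<inter> B) \<inter> A)"
    by (rule emeasure_mono_AE) (use AB(2,6) R in \<open>simp del: vimage_Int\<close>)
  also have "\<dots> = emeasure M (R \<inter> B)" using AB(2,7) R by (simp del: vimage_Int)
  also have "\<dots> \<le> emeasure M R" using R by (intro emeasure_mono) auto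
  finally show ?thesis .
qed

section \<open>Functions with values in an equilateral triangle\<close>

definition vertex :: "nat \<Rightarrow> complex" where
  "vertex i = cis (2 * pi / 3 * real i)"

lemma norm_vertex [simp]: "norm (vertex i) = 1"
  by (simp add: vertex_def)

lemma vertex_values:
  "vertex 0 = 1" "vertex 1 = Complex (- 1 / 2) (sqrt 3 / 2)" "vertex 2 = Complex (- 1 / 2) (- sqrt 3 / 2)"
proof -
  show "vertex 0 = 1" by (simp add: vertex_def)
  show "vertex 1 = Complex (- 1 / 2) (sqrt 3 / 2)"
    by (simp add: vertex_def complex_eq_iff cos_120 sin_120)
  have "cos (4 * pi / 3) = - 1 / 2" "sin (4 * pi / 3) = - sqrt 3 / 2"
    using cos_periodic_pi[of "pi / 3"] sin_periodic_pi[of "pi / 3"]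
    by (simp_all add: cos_60 sin_60 field_simps)
  thus "vertex 2 = Complex (- 1 / 2) (- sqrt 3 / 2)"
    by (simp add: vertex_def complex_eq_iff)
qed

lemma dist_vertex:
  assumes "i < 3" "j < 3" "i \<noteq> j"
  shows "cmod (vertex i - vertex j) = sqrt 3"
proof -
  have i: "i \<in> {0, 1, 2}" and j: "j \<in> {0, 1, 2}" using assms by auto
  have "(cmod (vertex i - vertex j))\<^sup>2 = 3"
    using i j assms(3) unfolding cmod_power2
    by (elim insertE emptyE; simp add: vertex_values[simplified] power2_eq_square)
  thus ?thesis by (metis norm_ge_zero real_sqrt_unique)
qed

text \<open>Because the vertices sum to zero, \<open>\<Sum> (vertex i - z) \<bullet> vertex i = 3\<close>.\<close>

lemma sum_dist_vertex_ge: "3 \<le> cmod (vertex 0 - z) + cmod (vertex 1 - z) + cmod (vertex 2 - z)"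
proof -
  have "(vertex i - z) \<bullet> vertex i \<le> cmod (vertex i - z)" for i
    using Cauchy_Schwarz_ineq2[of "vertex i - z" "vertex i"] by simp
  from this[of 0] this[of 1] this[of 2]
  have "(vertex 0 - z) \<bullet> vertex 0 + (vertex 1 - z) \<bullet> vertex 1 + (vertex 2 - z) \<bullet> vertex 2
      \<le> cmod (vertex 0 - z) + cmod (vertex 1 - z) + cmod (vertex 2 - z)" by linarith
  moreover have "(vertex 0 - z) \<bullet> vertex 0 + (vertex 1 - z) \<bullet> vertex 1 + (vertex 2 - z) \<bullet> vertex 2 = 3"
    by (simp add: vertex_values[simplified] inner_complex_def algebra_simps)
  ultimately show ?thesis by simp
qed

text \<open>The premise on \<open>a\<close> and \<open>b\<close> is what a ratio of at least
  \<open>C\<close> means for a move from vertex \<open>a\<close> to vertex \<open>b\<close>. If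
  \<open>z\<close> is no vertex, staying is impossible, and if all three edges were admissible,
  adding up would give \<open>6 * C \<le> 3 * sqrt 3\<close>; so some edge is missing and its two
  ends must both move to the third vertex \<open>i\<close>. If \<open>z\<close> is vertex
  \<open>i\<close>, the opposite edge only has ratio 1/2 and the other two vertices cannot
  stay.\<close>

lemma exists_forced_vertex:
  assumes C: "C > sqrt 3 / 2"
  shows "\<exists>i<3. \<forall>a<3. \<forall>b<3. a \<noteq> i \<longrightarrow>
    (if a = b then vertex a = z else C * (cmod (vertex a - z) + cmod (vertex b - z)) \<le> sqrt 3) \<longrightarrow> b = i"
proof (cases "\<exists>i<3. z = vertex i")
  case True
  then obtain i where i: "i < 3" "z = vertex i" by auto
  show ?thesis
  proof (intro exI[of _ i] conjI allI impI)
    fix a b :: nat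
    assume ab: "a < 3" "b < 3" "a \<noteq> i"
      "if a = b then vertex a = z else C * (cmod (vertex a - z) + cmod (vertex b - z)) \<le> sqrt 3"
    show "b = i"
    proof (rule ccontr)
      assume "b \<noteq> i"
      have "a \<noteq> b" using ab dist_vertex[of a i] i by auto
      hence "C * (2 * sqrt 3) \<le> sqrt 3"
        using ab dist_vertex[of a i] dist_vertex[of b i] i \<open>b \<noteq> i\<close> by simp
      hence "C * 2 \<le> 1" by simp
      moreover have "sqrt 3 > 1" by simp
      ultimately show False using C by linarith
    qed
  qed (use i in simp)
next
  case False
  have "\<exists>i<3. \<forall>a<3. \<forall>b<3. a \<noteq> i \<longrightarrow> b \<noteq> i \<longrightarrow> a \<noteq> b \<longrightarrow> \<not> C * (cmod (vertex a - z) + cmod (vertex b - z)) \<le> sqrt 3"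
  proof (rule ccontr)
    assume "\<not> ?thesis"
    hence H: "\<And>i. i < 3 \<Longrightarrow> \<exists>a<3. \<exists>b<3. a \<noteq> i \<and> b \<noteq> i \<and> a \<noteq> b \<and> C * (cmod (vertex a - z) + cmod (vertex b - z)) \<le> sqrt 3"
      by blast
    have 0: "C * (cmod (vertex 1 - z) + cmod (vertex 2 - z)) \<le> sqrt 3"
    proof -
      obtain a b where "a < 3" "b < 3" "a \<noteq> 0" "b \<noteq> 0" "a \<noteq> b" "C * (cmod (vertex a - z) + cmod (vertex b - z)) \<le> sqrt 3"
        using H[of 0] by auto
      moreover from this have "(a = 1 \<and> b = 2) \<or> (a = 2 \<and> b = 1)" by linarith
      ultimately show ?thesis by (auto simp: add.commute)
    qed
    have 1: "C * (cmod (vertex 0 - z) + cmod (vertex 2 - z)) \<le> sqrt 3"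
    proof -
      obtain a b where "a < 3" "b < 3" "a \<noteq> 1" "b \<noteq> 1" "a \<noteq> b" "C * (cmod (vertex a - z) + cmod (vertex b - z)) \<le> sqrt 3"
        using H[of 1] by auto
      moreover from this have "(a = 0 \<and> b = 2) \<or> (a = 2 \<and> b = 0)" by linarith
      ultimately show ?thesis by (auto simp: add.commute)
    qed
    have 2: "C * (cmod (vertex 0 - z) + cmod (vertex 1 - z)) \<le> sqrt 3"
    proof -
      obtain a b where "a < 3" "b < 3" "a \<noteq> 2" "b \<noteq> 2" "a \<noteq> b" "C * (cmod (vertex a - z) + cmod (vertex b - z)) \<le> sqrt 3"
        using H[of 2] by auto
      moreover from this have "(a = 0 \<and> b = 1) \<or> (a = 1 \<and> b = 0)" by linarith
      ultimately show ?thesis by (auto simp: add.commute)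
    qed
    have "C > 0" using C real_sqrt_ge_zero[of 3] by linarith
    hence "C * 3 \<le> C * (cmod (vertex 0 - z) + cmod (vertex 1 - z) + cmod (vertex 2 - z))"
      using sum_dist_vertex_ge by (intro mult_left_mono) auto
    hence "C * 6 \<le> 3 * sqrt 3" using 0 1 2 by (simp add: algebra_simps)
    thus False using C by simp
  qed
  thus ?thesis using False by metis
qed

text \<open>A point that keeps its vertex has ratio 0, except at \<open>z\<close> itself, where the
  convention 0/0 = 1 applies.\<close>

lemma ratio_vertices:
  assumes "i < 3" "j < 3" "g x = vertex i" "g (T x) = vertex j" "0 < C" "C \<le> ratio g T z x"
  shows "if i = j then vertex i = z else C * (cmod (vertex i - z) + cmod (vertex j - z)) \<le> sqrt 3"
proof (cases "i = j")
  case True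
  thus ?thesis using assms by (auto simp: ratio_def split: if_splits)
next
  case False
  have "cmod (vertex i - z) + cmod (vertex j - z) \<noteq> 0"
  proof
    assume "cmod (vertex i - z) + cmod (vertex j - z) = 0"
    hence "vertex i = z" "vertex j = z" by (simp_all add: add_nonneg_eq_0_iff)
    thus False using dist_vertex[of i j] assms False by simp
  qed
  hence pos: "cmod (vertex i - z) + cmod (vertex j - z) > 0" by (smt (verit) norm_ge_zero)
  hence "C \<le> sqrt 3 / (cmod (vertex i - z) + cmod (vertex j - z))"
    using assms dist_vertex[of i j] False by (simp add: ratio_def)
  thus ?thesis using pos False by (simp add: le_divide_eq)
qed

text \<open>A larger essential infimum would force \<open>T\<close> to map almost all of the two
  level sets other than \<open>i\<close> into the level set of \<open>i\<close>, which carries less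
  than half of the mass.\<close>

lemma (in finite_measure) Lam_three_points_le:
  assumes nontriv: "emeasure M (space M) \<noteq> 0"
    and [measurable]: "c \<in> measurable M (count_space UNIV)" and c: "\<And>x. x \<in> space M \<Longrightarrow> c x < (3::nat)"
    and small: "\<And>i. i < 3 \<Longrightarrow> measure M {x \<in> space M. c x = i} < measure M (space M) / 2"
    and T: "T \<in> Aut M"
  shows "Lam M (\<lambda>x. vertex (c x)) T z \<le> sqrt 3 / 2"
proof (rule Lam_le[OF nontriv], rule ccontr)
  fix C assume ae: "AE x in M. C \<le> ratio (\<lambda>x. vertex (c x)) T z x" and "\<not> C \<le> sqrt 3 / 2"
  hence C: "C > sqrt 3 / 2" by simp
  hence "C > 0" using real_sqrt_ge_zero[of 3] by linarith
  obtain i where i: "i < 3" and forced: "\<And>a b. a < 3 \<Longrightarrow> b < 3 \<Longrightarrow> a \<noteq> i \<Longrightarrow>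
    (if a = b then vertex a = z else C * (cmod (vertex a - z) + cmod (vertex b - z)) \<le> sqrt 3) \<Longrightarrow> b = i"
    using exists_forced_vertex[OF C, of z] by metis
  have "AE x in M. x \<in> {x \<in> space M. c x \<noteq> i} \<longrightarrow> T x \<in> {x \<in> space M. c x = i}"
    using ae Aut_AE_space[OF T]
  proof eventually_elim
    case (elim x)
    show ?case
    proof
      assume x: "x \<in> {x \<in> space M. c x \<noteq> i}"
      have "if c x = c (T x) then vertex (c x) = z else C * (cmod (vertex (c x) - z) + cmod (vertex (c (T x)) - z)) \<le> sqrt 3"
        using elim x c \<open>C > 0\<close> by (intro ratio_vertices[where g = "\<lambda>x. vertex (c x)" and T = T and x = x]) auto
      thus "T x \<in> {x \<in> space M. c x = i}" using forced[of "c x" "c (T x)"] x c elim by auto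
    qed
  qed
  hence "emeasure M {x \<in> space M. c x \<noteq> i} \<le> emeasure M {x \<in> space M. c x = i}"
    by (intro Aut_emeasure_le[OF T]) auto
  hence "measure M {x \<in> space M. c x \<noteq> i} \<le> measure M {x \<in> space M. c x = i}"
    by (simp add: emeasure_eq_measure)
  moreover have "measure M {x \<in> space M. c x \<noteq> i} = measure M (space M) - measure M {x \<in> space M. c x = i}"
    using finite_measure_compl[of "{x \<in> space M. c x = i}"]
    by (auto simp: set_diff_eq intro!: arg_cong[where f = "measure M"] elim!: trans[rotated])
  ultimately show False using small[OF i] by linarith
qed

text \<open>All vertices have distance 1 from \<open>z = 0\<close>, so a \<open>T\<close> that
  changes the vertex almost everywhere attains sqrt 3 / 2 there.\<close>

lemma (in finite_measure) three_points_extremal: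
  assumes nontriv: "emeasure M (space M) \<noteq> 0"
    and c_meas [measurable]: "c \<in> measurable M (count_space UNIV)" and c: "\<And>x. x \<in> space M \<Longrightarrow> c x < (3::nat)"
    and small: "\<And>i. i < 3 \<Longrightarrow> measure M {x \<in> space M. c x = i} < measure M (space M) / 2"
    and T: "T \<in> Aut M" and move: "AE x in M. c (T x) \<noteq> c x"
    and lower: "\<And>g. g \<in> borel_measurable M \<Longrightarrow> sqrt 3 / 2 \<le> LamSup M g"
  shows "LamInf M = sqrt 3 / 2 \<and> (\<exists>g T z. g \<in> Linf M \<and> T \<in> Aut M \<and> Lam M g T z = LamSup M g \<and> LamSup M g = LamInf M)"
proof -
  define g where "g = (\<lambda>x. vertex (c x))"
  have [measurable]: "g \<in> borel_measurable M" unfolding g_def by measurable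
  have le: "Lam M g T' z \<le> sqrt 3 / 2" if "T' \<in> Aut M" for T' z
    unfolding g_def by (rule Lam_three_points_le[OF nontriv c_meas c small that])
  have "AE x in M. sqrt 3 / 2 \<le> ratio g T 0 x"
    using move Aut_AE_space[OF T] AE_space
    by eventually_elim (use c dist_vertex in \<open>auto simp: ratio_def g_def\<close>)
  hence "sqrt 3 / 2 \<le> Lam M g T 0" by (rule Lam_ge[OF nontriv])
  hence Lam: "Lam M g T 0 = sqrt 3 / 2" using le[OF T, of 0] by linarith
  have Sup: "LamSup M g = sqrt 3 / 2"
    using lower[of g] LamSup_le[OF nontriv, of g "sqrt 3 / 2"] le by (intro antisym) auto
  have Inf: "LamInf M = sqrt 3 / 2"
    using LamInf_le[OF nontriv, of g] LamInf_ge[OF nontriv lower] Sup by (intro antisym) auto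
  have "g \<in> Linf M" unfolding Linf_def by (auto simp: g_def intro!: exI[of _ 1])
  thus ?thesis using Lam Sup Inf T by metis
qed

section \<open>Extremal functions on finite spaces\<close>

lemma finite_measure_Omega_fin: "finite_measure (Omega_fin n)"
  by (rule finite_measureI) (simp add: emeasure_Omega_fin)

lemma measure_Omega_fin: "A \<subseteq> {1..n} \<Longrightarrow> measure (Omega_fin n) A = card A / n"
  by (simp add: Omega_fin_def measure_uniform_count_measure)

lemma Omega_fin_extremal:
  assumes n: "n \<ge> 3" "n \<noteq> 4"
  shows "LamInf (Omega_fin n) = sqrt 3 / 2 \<and> (\<exists>g T z. g \<in> Linf (Omega_fin n) \<and> T \<in> Aut (Omega_fin n) \<and>
    Lam (Omega_fin n) g T z = LamSup (Omega_fin n) g \<and> LamSup (Omega_fin n) g = LamInf (Omega_fin n))"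
proof -
  interpret finite_measure "Omega_fin n" by (rule finite_measure_Omega_fin)
  \<comment> \<open>Consecutive blocks of sizes \<open>a\<close>, \<open>a\<close> and
    \<open>n - 2 * a\<close>. The last size is 1 for odd \<open>n\<close> and 2 for even
    \<open>n\<close>, which is less than \<open>n / 2\<close> except for
    \<open>n = 4\<close>.\<close>
  define a where "a = (n - 1) div 2"
  define p where "p = n div 2"
  have ap: "2 * a + 1 \<le> n" "n \<le> 2 * a + 2" "2 * p \<le> n" "n \<le> 2 * p + 1"
    using n by (auto simp: a_def p_def)
  define c where "c = (\<lambda>x. if x \<le> a then 0 else if x \<le> 2 * a then 1 else (2::nat))"
  define T where "T = Suc \<circ> (\<lambda>y. (y + p) mod n) \<circ> (\<lambda>x. x - 1)"
  have "bij_betw (\<lambda>x. x - 1) {1..n} {..<n}"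
    by (rule bij_betw_byWitness[where f' = Suc]) (use n in auto)
  moreover have "bij_betw (\<lambda>y. (y + p) mod n) {..<n} {..<n}"
    using n by (intro bij_betw_rotate) (simp add: p_def)
  moreover have "bij_betw Suc {..<n} {1..n}"
    by (rule bij_betw_byWitness[where f' = "\<lambda>x. x - 1"]) auto
  ultimately have T: "bij_betw T {1..n} {1..n}"
    unfolding T_def comp_assoc by (intro bij_betw_trans[where B = "{..<n}"])
  have "c (T x) \<noteq> c x" if x: "x \<in> {1..n}" for x
  proof -
    have Tx: "T x = (if x + p \<le> n then x + p else x + p - n)"
    proof (cases "x + p \<le> n")
      case True
      hence "(x - 1 + p) mod n = x - 1 + p" using x n by (intro mod_less) auto
      thus ?thesis using True x by (simp add: T_def)
    next
      case False
      hence "(x - 1 + p) mod n = (x - 1 + p - n) mod n" using x by (intro le_mod_geq) auto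
      also have "\<dots> = x - 1 + p - n" using x ap n by (intro mod_less) auto
      finally show ?thesis using False x by (simp add: T_def)
    qed
    have x': "1 \<le> x" "x \<le> n" using x by auto
    \<comment> \<open>The rotation by \<open>p \<ge> a\<close> leaves every block: the first moves
      to the right without wrapping (\<open>A\<close>), the last wraps and stays below its start
      (\<open>B\<close>), and the middle reaches the last block (\<open>C\<close>) or, if it wraps,
      the first (\<open>D\<close>).\<close>
    have A: "a < x + p" "x + p \<le> n" if "x \<le> a" using that x' ap by linarith+
    have B: "n < x + p" "x + p \<le> 2 * a + n" if "2 * a < x" using that x' ap n by presburger+
    have C: "2 * a < x + p" if "a < x" using that ap by linarith
    have D: "x + p \<le> a + n" if "x \<le> 2 * a" using that ap by linarith
    consider "x \<le> a" | "a < x" "x \<le> 2 * a" "x + p \<le> n" | "a < x" "x \<le> 2 * a" "n < x + p" | "2 * a < x" "a < x"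
      by linarith
    thus ?thesis
    proof cases
      case 1 thus ?thesis using Tx A by (simp add: c_def)
    next
      case 2 thus ?thesis using Tx C by (simp add: c_def)
    next
      case 3 thus ?thesis using Tx D by (simp add: c_def)
    next
      case 4 thus ?thesis using Tx B by (simp add: c_def)
    qed
  qed
  moreover have small: "real (card {x \<in> {1..n}. c x = i}) * 2 < real n" if "i < 3" for i
  proof -
    have i: "i = 0 \<or> i = 1 \<or> i = 2" using that by linarith
    have "{x \<in> {1..n}. c x = 0} = {1..a}" using ap by (auto simp: c_def)
    moreover have "{x \<in> {1..n}. c x = 1} = {a<..2 * a}" using ap by (auto simp: c_def)
    moreover have "{x \<in> {1..n}. c x = 2} = {2 * a<..n}" by (auto simp: c_def)
    moreover have "(n - 2 * a) * 2 < n" using ap n by presburger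
    ultimately have "card {x \<in> {1..n}. c x = i} * 2 < n" using i ap n by auto
    thus ?thesis by linarith
  qed
  have "measure (Omega_fin n) {x \<in> space (Omega_fin n). c x = i} < measure (Omega_fin n) (space (Omega_fin n)) / 2"
    if "i < 3" for i
  proof -
    have "measure (Omega_fin n) {x \<in> {1..n}. c x = i} = real (card {x \<in> {1..n}. c x = i}) / real n"
      by (rule measure_Omega_fin) auto
    moreover have "\<dots> < 1 / 2" using small[OF that] n by (simp add: field_simps)
    moreover have "measure (Omega_fin n) {1..n} = 1" using n by (simp add: measure_Omega_fin)
    ultimately show ?thesis by (simp only: space_Omega_fin)
  qed
  ultimately show ?thesis
    using n T LamSup_Omega_fin_ge[of n]
    by (intro three_points_extremal[where c = c and T = T] permutation_in_Aut_Omega_fin nontriv_Omega_fin AE_I2)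
      (auto simp: c_def measurable_def)
qed

lemma LamInf_eq_1_extremal:
  assumes nontriv: "emeasure M (space M) \<noteq> 0"
    and one: "\<And>g. \<exists>T\<in>Aut M. \<exists>z. AE x in M. 1 \<le> ratio g T z x"
  shows "LamInf M = 1 \<and> (\<exists>g T z. g \<in> Linf M \<and> T \<in> Aut M \<and> Lam M g T z = LamSup M g \<and> LamSup M g = LamInf M)"
proof -
  have ex: "\<exists>T\<in>Aut M. \<exists>z. Lam M g T z = 1" for g
    using one[of g] Lam_ge[OF nontriv] Lam_le_1[OF nontriv] by (meson antisym)
  have Sup: "LamSup M g = 1" for g
    using ex[of g] Lam_le_LamSup[OF nontriv, of _ g] LamSup_le[OF nontriv, of g 1] Lam_le_1[OF nontriv]
    by (metis antisym)
  have Inf: "LamInf M = 1"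
    using LamInf_le_1[OF nontriv] LamInf_ge[OF nontriv, of 1] Sup by (intro antisym) auto
  have "(\<lambda>_. 0) \<in> Linf M" unfolding Linf_def by (auto intro!: exI[of _ 0])
  thus ?thesis using ex[of "\<lambda>_. 0"] Sup Inf by metis
qed

text \<open>With \<open>z\<close> the only value of \<open>g\<close>, the ratio is 0/0 = 1.\<close>

lemma Omega_fin_1:
  "LamInf (Omega_fin 1) = 1 \<and> (\<exists>g T z. g \<in> Linf (Omega_fin 1) \<and> T \<in> Aut (Omega_fin 1) \<and>
    Lam (Omega_fin 1) g T z = LamSup (Omega_fin 1) g \<and> LamSup (Omega_fin 1) g = LamInf (Omega_fin 1))"
proof (rule LamInf_eq_1_extremal)
  fix g :: "nat \<Rightarrow> complex"
  have "id \<in> Aut (Omega_fin 1)" by (intro permutation_in_Aut_Omega_fin) simp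
  moreover have "AE x in Omega_fin 1. 1 \<le> ratio g id (g 1) x"
    by (intro AE_I2) (simp add: ratio_center)
  ultimately show "\<exists>T\<in>Aut (Omega_fin 1). \<exists>z. AE x in Omega_fin 1. 1 \<le> ratio g T z x" by blast
qed (rule nontriv_Omega_fin, simp)

text \<open>For the swap and the midpoint \<open>z\<close> of the two values the triangle inequality
  is an equality; if the values coincide, the ratio is 0/0 = 1.\<close>

lemma Omega_fin_2:
  "LamInf (Omega_fin 2) = 1 \<and> (\<exists>g T z. g \<in> Linf (Omega_fin 2) \<and> T \<in> Aut (Omega_fin 2) \<and>
    Lam (Omega_fin 2) g T z = LamSup (Omega_fin 2) g \<and> LamSup (Omega_fin 2) g = LamInf (Omega_fin 2))"
proof (rule LamInf_eq_1_extremal)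
  fix g :: "nat \<Rightarrow> complex"
  define T where "T = (\<lambda>x::nat. 3 - x)"
  define z where "z = (g 1 + g 2) / 2"
  have "bij_betw T {1..2} {1..2}"
    by (rule bij_betw_byWitness[where f' = T]) (auto simp: T_def)
  hence "T \<in> Aut (Omega_fin 2)" by (rule permutation_in_Aut_Omega_fin)
  moreover have "AE x in Omega_fin 2. 1 \<le> ratio g T z x"
  proof (rule AE_I2)
    fix x assume "x \<in> space (Omega_fin 2)"
    hence "x = 1 \<or> x = 2" by auto
    hence "g x - z = (g x - g (T x)) / 2" "g (T x) - z = - ((g x - g (T x)) / 2)"
      by (auto simp: T_def z_def field_simps)
    hence "cmod (g x - z) + cmod (g (T x) - z) = cmod (g x - g (T x))"
      by (simp only: norm_minus_cancel norm_divide) simp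
    thus "1 \<le> ratio g T z x" unfolding ratio_def by simp
  qed
  ultimately show "\<exists>T\<in>Aut (Omega_fin 2). \<exists>z. AE x in Omega_fin 2. 1 \<le> ratio g T z x" by blast
qed (rule nontriv_Omega_fin, simp)

subsection \<open>Half turns of the unit interval\<close>

lemma Aut_inv:
  assumes T: "T \<in> Aut M"
  shows "\<exists>T'\<in>Aut M. AE y in M. T (T' y) = y"
proof -
  obtain A B where AB: "A \<in> sets M" "B \<in> sets M" "AE x in M. x \<in> A" "AE x in M. x \<in> B"
    "bij_betw T A B" and pre: "\<And>S. S \<in> sets M \<Longrightarrow> S \<subseteq> B \<Longrightarrow> T -` S \<inter> A \<in> sets M"
    and em: "\<And>S. S \<in> sets M \<Longrightarrow> S \<subseteq> B \<Longrightarrow> emeasure M (T -` S \<inter> A) = emeasure M S"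
    and im: "\<And>S. S \<in> sets M \<Longrightarrow> S \<subseteq> A \<Longrightarrow> T ` S \<in> sets M"
    using AutE[OF T] by metis
  define T' where "T' = the_inv_into A T"
  have inj: "inj_on T A" and TA: "T ` A = B" using AB(5) by (auto simp: bij_betw_def)
  have TT': "T (T' y) = y" "T' y \<in> A" if "y \<in> B" for y
    using that inj TA unfolding T'_def by (auto simp: f_the_inv_into_f the_inv_into_into)
  have T'T: "T' (T x) = x" if "x \<in> A" for x
    using that inj unfolding T'_def by (rule the_inv_into_f_f[rotated])
  have pre': "T' -` S \<inter> B = T ` S" if "S \<subseteq> A" for S
    using that TA TT' T'T by (auto simp: image_iff)
  have im': "T' ` S = T -` S \<inter> A" if "S \<subseteq> B" for S
    using that TT' T'T by (auto simp: image_iff subset_iff) metis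
  have em': "emeasure M (T ` S) = emeasure M S" if "S \<in> sets M" "S \<subseteq> A" for S
  proof -
    have "T -` (T ` S) \<inter> A = S" using that(2) inj by (auto simp: inj_on_def)
    thus ?thesis using em[of "T ` S"] im that TA by (metis image_mono)
  qed
  have "T' \<in> Aut M"
  proof (rule AutI[OF AB(2,1,4,3)])
    show "bij_betw T' B A" unfolding T'_def using AB(5) by (rule bij_betw_the_inv_into)
  qed (simp_all add: pre' im' pre em' im)
  moreover have "AE y in M. T (T' y) = y" using AB(4) by eventually_elim (rule TT')
  ultimately show ?thesis by blast
qed

lemma Aut_comp:
  assumes S: "S \<in> Aut M" and T: "T \<in> Aut M"
  shows "T \<circ> S \<in> Aut M"
proof -
  obtain A B where AB: "A \<in> sets M" "B \<in> sets M" "AE x in M. x \<in> A" "AE x in M. x \<in> B"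
    "bij_betw S A B" and pre: "\<And>X. X \<in> sets M \<Longrightarrow> X \<subseteq> B \<Longrightarrow> S -` X \<inter> A \<in> sets M"
    and em: "\<And>X. X \<in> sets M \<Longrightarrow> X \<subseteq> B \<Longrightarrow> emeasure M (S -` X \<inter> A) = emeasure M X"
    and im: "\<And>X. X \<in> sets M \<Longrightarrow> X \<subseteq> A \<Longrightarrow> S ` X \<in> sets M"
    using AutE[OF S] by metis
  obtain A2 B2 where AB2: "A2 \<in> sets M" "B2 \<in> sets M" "AE x in M. x \<in> A2" "AE x in M. x \<in> B2"
    "bij_betw T A2 B2" and pre2: "\<And>X. X \<in> sets M \<Longrightarrow> X \<subseteq> B2 \<Longrightarrow> T -` X \<inter> A2 \<in> sets M"
    and em2: "\<And>X. X \<in> sets M \<Longrightarrow> X \<subseteq> B2 \<Longrightarrow> emeasure M (T -` X \<inter> A2) = emeasure M X"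
    and im2: "\<And>X. X \<in> sets M \<Longrightarrow> X \<subseteq> A2 \<Longrightarrow> T ` X \<in> sets M"
    using AutE[OF T] by metis
  have inj: "inj_on S A" and SA: "S ` A = B" using AB(5) by (auto simp: bij_betw_def)
  have inj2: "inj_on T A2" and TA: "T ` A2 = B2" using AB2(5) by (auto simp: bij_betw_def)
  \<comment> \<open>\<open>S\<close> hits the domain of \<open>T\<close> only almost everywhere, so
    the composition is restricted to the points that \<open>S\<close> sends into
    \<open>D\<close>.\<close>
  define D where "D = B \<inter> A2"
  have D: "D \<in> sets M" "D \<subseteq> B" "D \<subseteq> A2" using AB AB2 by (auto simp: D_def)
  define A' where "A' = S -` D \<inter> A"
  have SA': "S ` A' = D" using SA D(2) by (auto simp: A'_def)
  have preT: "T -` X \<inter> A2 \<subseteq> D" if "X \<subseteq> T ` D" for X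
    using that inj2 D(3) by (auto simp: inj_on_def subset_iff image_iff)
  have preTS: "(T \<circ> S) -` X \<inter> A' = S -` (T -` X \<inter> A2) \<inter> A" if "X \<subseteq> T ` D" for X
    using preT[OF that] D(3) by (auto simp: A'_def)
  have TD: "T ` D \<subseteq> B2" using TA D(3) by auto
  \<comment> \<open>The inverse shows that the image of \<open>D\<close> has full measure: almost
    every \<open>y\<close> is \<open>T (T' y)\<close> with \<open>T' y\<close> in
    \<open>D\<close>.\<close>
  obtain T' where T': "T' \<in> Aut M" "AE y in M. T (T' y) = y" using Aut_inv[OF T] by auto
  show ?thesis
  proof (rule AutI[of A' M "T ` D"])
    show "A' \<in> sets M" unfolding A'_def using pre D by simp
    show "T ` D \<in> sets M" using im2 D by simp
    show "AE x in M. x \<in> A'"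
      using AB(3) Aut_AE[OF S AB2(3)] by eventually_elim (use SA in \<open>auto simp: A'_def D_def\<close>)
    show "AE y in M. y \<in> T ` D"
      using T'(2) Aut_AE[OF T'(1) AB(4)] Aut_AE[OF T'(1) AB2(3)]
      by eventually_elim (auto simp: D_def image_iff intro: sym)
    have "bij_betw S A' D" using inj SA' by (auto simp: bij_betw_def A'_def intro: inj_on_subset)
    moreover have "bij_betw T D (T ` D)" using inj2 D(3) by (auto simp: bij_betw_def intro: inj_on_subset)
    ultimately show "bij_betw (T \<circ> S) A' (T ` D)" by (rule bij_betw_trans)
  next
    fix X assume X: "X \<in> sets M" "X \<subseteq> T ` D"
    have X2: "T -` X \<inter> A2 \<in> sets M" "T -` X \<inter> A2 \<subseteq> B" "emeasure M (T -` X \<inter> A2) = emeasure M X"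
      using pre2[of X] em2[of X] X TD preT[OF X(2)] D(2) by auto
    show "(T \<circ> S) -` X \<inter> A' \<in> sets M" unfolding preTS[OF X(2)] using pre[OF X2(1,2)] .
    show "emeasure M ((T \<circ> S) -` X \<inter> A') = emeasure M X"
      unfolding preTS[OF X(2)] em[OF X2(1,2)] by (rule X2(3))
  next
    fix X assume X: "X \<in> sets M" "X \<subseteq> A'"
    have "S ` X \<in> sets M" using X by (intro im) (auto simp: A'_def)
    moreover have "S ` X \<subseteq> A2" using X SA' D(3) by auto
    ultimately have "T ` (S ` X) \<in> sets M" by (rule im2)
    thus "(T \<circ> S) ` X \<in> sets M" by (simp add: image_comp)
  qed
qed

section \<open>Masses and rotations on the unit interval\<close>

lemma space_Omega_inf [simp]: "space Omega_inf = {0..1}"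
  by (simp add: Omega_inf_def)

lemma sets_Omega_inf_iff: "X \<in> sets Omega_inf \<longleftrightarrow> X \<in> sets lebesgue \<and> X \<subseteq> {0..1}"
  by (auto simp: Omega_inf_def sets_restrict_space_iff)

lemma measure_Omega_inf: "X \<subseteq> {0..1} \<Longrightarrow> measure Omega_inf X = measure lebesgue X"
  unfolding Omega_inf_def by (rule measure_restrict_space) auto

lemma emeasure_Omega_inf: "X \<subseteq> {0..1} \<Longrightarrow> emeasure Omega_inf X = emeasure lebesgue X"
  unfolding Omega_inf_def by (rule emeasure_restrict_space) auto

lemma finite_measure_Omega_inf: "finite_measure Omega_inf"
  unfolding Omega_inf_def by (rule finite_measure_lebesgue_on) simp

interpretation Inf: finite_measure Omega_inf
  by (rule finite_measure_Omega_inf)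

lemma measure_Omega_inf_space [simp]: "measure Omega_inf {0..1} = 1"
  by (simp add: measure_Omega_inf)

lemma nontriv_Omega_inf: "emeasure Omega_inf (space Omega_inf) \<noteq> 0"
  by (simp add: emeasure_Omega_inf)

lemma AE_Omega_inf_not_in: "N \<in> null_sets lebesgue \<Longrightarrow> AE x in Omega_inf. x \<notin> N"
  unfolding Omega_inf_def by (subst AE_restrict_space_iff) (auto intro: AE_mp[OF AE_not_in])

definition mass_below :: "real set \<Rightarrow> real \<Rightarrow> real" where
  "mass_below D x = measure Omega_inf (D \<inter> {..x})"

text \<open>The Lipschitz bound gives continuity for the intermediate value arguments and later
  shows that the branches of the rank map send null sets to null sets.\<close>

lemma mass_below:
  assumes D: "D \<in> sets Omega_inf"
  shows mass_below_mono: "x \<le> y \<Longrightarrow> mass_below D x \<le> mass_below D y"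
    and mass_below_lipschitz: "\<bar>mass_below D y - mass_below D x\<bar> \<le> \<bar>y - x\<bar>"
    and mass_below_0: "mass_below D 0 = 0"
    and mass_below_1: "mass_below D 1 = measure Omega_inf D"
proof -
  have sub: "D \<subseteq> {0..1}" "D \<in> sets lebesgue" using D by (auto simp: sets_Omega_inf_iff)
  have set: "D \<inter> I \<in> sets Omega_inf" if "I \<in> sets borel" for I
    using that sub by (auto simp: sets_Omega_inf_iff)
  show mono: "mass_below D x \<le> mass_below D y" if "x \<le> y" for x y
    unfolding mass_below_def using that set by (intro Inf.finite_measure_mono) auto
  have lip: "mass_below D y \<le> mass_below D x + (y - x)" if "x \<le> y" for x y
  proof -
    have "mass_below D y \<le> measure Omega_inf ((D \<inter> {..x}) \<union> (D \<inter> {x<..y}))"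
      unfolding mass_below_def using set by (intro Inf.finite_measure_mono) auto
    also have "\<dots> \<le> mass_below D x + measure Omega_inf (D \<inter> {x<..y})"
      unfolding mass_below_def using set by (intro measure_Un_le) auto
    also have "measure Omega_inf (D \<inter> {x<..y}) = measure lebesgue (D \<inter> {x<..y})"
      using sub by (intro measure_Omega_inf) auto
    also have "\<dots> \<le> measure lebesgue {x..y}" using sub by (intro measure_mono_fmeasurable) auto
    also have "\<dots> = y - x" using that by simp
    finally show ?thesis by simp
  qed
  show "\<bar>mass_below D y - mass_below D x\<bar> \<le> \<bar>y - x\<bar>" for x y
    using mono[of x y] mono[of y x] lip[of x y] lip[of y x] by linarith
  have "measure lebesgue (D \<inter> {..0}) \<le> measure lebesgue (cbox 0 (0::real))"
    using sub by (intro measure_mono_fmeasurable lmeasurable_cbox) auto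
  hence "measure lebesgue (D \<inter> {..0}) = 0" by (simp add: antisym)
  thus "mass_below D 0 = 0" unfolding mass_below_def using sub by (subst measure_Omega_inf) auto
  have "D \<inter> {..1} = D" using sub by auto
  thus "mass_below D 1 = measure Omega_inf D" by (simp add: mass_below_def)
qed

lemma continuous_on_mass_below: "D \<in> sets Omega_inf \<Longrightarrow> continuous_on UNIV (mass_below D)"
  by (intro lipschitz_on_continuous_on[where L = 1] lipschitz_onI)
    (auto simp: dist_real_def intro: mass_below_lipschitz)

text \<open>The mass of \<open>C\<close> to the left of a cut grows continuously from 0 to the mass
  of \<open>C\<close>.\<close>

lemma Omega_inf_subset_of_measure:
  assumes "C \<in> sets Omega_inf" "0 \<le> v" "v \<le> measure Omega_inf C"
  shows "\<exists>C1\<in>sets Omega_inf. C1 \<subseteq> C \<and> measure Omega_inf C1 = v"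
proof -
  have "\<exists>x. 0 \<le> x \<and> x \<le> 1 \<and> mass_below C x = v"
    using assms mass_below_0[OF assms(1)] mass_below_1[OF assms(1)]
      continuous_on_subset[OF continuous_on_mass_below[OF assms(1)]]
    by (intro IVT') auto
  then obtain x where "mass_below C x = v" by auto
  moreover have "C \<inter> {..x} \<in> sets Omega_inf" using assms by (auto simp: sets_Omega_inf_iff)
  ultimately show ?thesis by (intro bexI[of _ "C \<inter> {..x}"]) (auto simp: mass_below_def)
qed

definition half_shift :: "real \<Rightarrow> real" where
  "half_shift x = (if x < 1 / 2 then x + 1 / 2 else x - 1 / 2)"

text \<open>On \<open>{0..<1}\<close> the map is an involution, so preimages are images, and it
  translates the two halves separately. The point 1 is left out because it shares the image 1/2 with
  0.\<close>

lemma half_shift_in_Aut: "half_shift \<in> Aut Omega_inf"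
proof -
  let ?A = "{0..<1::real}"
  have inv: "half_shift (half_shift x) = x" "half_shift x \<in> ?A" if "x \<in> ?A" for x
    using that by (auto simp: half_shift_def)
  have pre: "half_shift -` X \<inter> ?A = half_shift ` X" if "X \<subseteq> ?A" for X
    using that inv by (auto simp: image_iff subset_iff) metis
  have im: "half_shift ` X = (+) (1/2) ` (X \<inter> {..<1/2}) \<union> (+) (- (1/2)) ` (X \<inter> {1/2..})" for X
    by (auto simp: half_shift_def image_iff)
  have meas: "half_shift ` X \<in> sets Omega_inf" "measure Omega_inf (half_shift ` X) = measure Omega_inf X"
    if X: "X \<in> sets Omega_inf" "X \<subseteq> ?A" for X
  proof -
    have leb: "X \<inter> I \<in> lmeasurable" if "I \<in> sets borel" for I
    proof (rule fmeasurableI2[of "{0..1}"])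
      show "X \<inter> I \<in> sets lebesgue" using X that by (auto simp: sets_Omega_inf_iff)
    qed (use X in auto)
    have s: "(+) a ` (X \<inter> I) \<in> lmeasurable" if "I \<in> sets borel" for a :: real and I
      using leb[OF that] by (rule measurable_translation)
    have sub: "half_shift ` X \<subseteq> ?A" using inv X by auto
    have "(+) (1/2) ` (X \<inter> {..<1/2}) \<in> sets lebesgue" "(+) (- (1/2)) ` (X \<inter> {1/2..}) \<in> sets lebesgue"
      by (rule fmeasurableD[OF s]; simp)+
    hence "half_shift ` X \<in> sets lebesgue" unfolding im by (rule sets.Un)
    thus "half_shift ` X \<in> sets Omega_inf" using sub by (auto simp: sets_Omega_inf_iff)
    have "measure Omega_inf (half_shift ` X) = measure lebesgue (half_shift ` X)"
      using sub by (intro measure_Omega_inf) auto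
    also have "\<dots> = measure lebesgue ((+) (1/2) ` (X \<inter> {..<1/2})) + measure lebesgue ((+) (- (1/2)) ` (X \<inter> {1/2..}))"
    proof -
      have "(+) (1/2) ` (X \<inter> {..<1/2}) \<inter> (+) (- (1/2)) ` (X \<inter> {1/2..}) = {}"
      proof -
        have "1 / 2 + y \<noteq> - (1 / 2) + w" if "y \<in> X" "w \<in> X" for y w
          using subsetD[OF X(2) that(1)] subsetD[OF X(2) that(2)] by auto
        thus ?thesis by blast
      qed
      moreover have "(+) (1/2) ` (X \<inter> {..<1/2}) \<in> lmeasurable" "(+) (- (1/2)) ` (X \<inter> {1/2..}) \<in> lmeasurable"
        by (rule s; simp)+
      ultimately show ?thesis unfolding im by (simp only: measure_Un3 measure_empty diff_zero)
    qed
    also have "\<dots> = measure lebesgue (X \<inter> {..<1/2}) + measure lebesgue (X \<inter> {1/2..})"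
      by (simp only: measure_translation)
    also have "\<dots> = measure lebesgue ((X \<inter> {..<1/2}) \<union> (X \<inter> {1/2..}))"
    proof -
      have "(X \<inter> {..<1/2}) \<inter> (X \<inter> {1/2..}) = {}" by auto
      thus ?thesis by (subst measure_Un3) (auto intro: leb)
    qed
    also have "(X \<inter> {..<1/2}) \<union> (X \<inter> {1/2..}) = X" by auto
    also have "measure lebesgue X = measure Omega_inf X"
      using X(2) by (intro measure_Omega_inf[symmetric]) auto
    finally show "measure Omega_inf (half_shift ` X) = measure Omega_inf X" .
  qed
  have "AE x in Omega_inf. x \<in> space Omega_inf \<and> x \<notin> {1}"
    by (intro AE_conjI AE_space AE_Omega_inf_not_in) (auto intro: null_sets_completionI)
  hence ae: "AE x in Omega_inf. x \<in> ?A" by eventually_elim auto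
  show ?thesis
  proof (rule AutI[OF _ _ ae ae])
    show "bij_betw half_shift ?A ?A"
      by (rule bij_betw_byWitness[where f' = half_shift]) (use inv in auto)
  qed (auto simp: pre meas Inf.emeasure_eq_measure sets_Omega_inf_iff[of ?A])
qed

text \<open>The rank map: it sorts \<open>[0, 1]\<close> by the value of \<open>j\<close>, ties being broken by position. It is
  injective off the preimage of a countable set of ranks, hence almost everywhere.\<close>

locale rank_map =
  fixes j :: "real \<Rightarrow> nat" and K :: nat
  assumes j_meas [measurable]: "j \<in> measurable Omega_inf (count_space UNIV)"
    and j_less: "\<And>x. x \<in> {0..1} \<Longrightarrow> j x < K"
begin

definition D :: "nat \<Rightarrow> real set" where "D i = {x \<in> {0..1}. j x = i}"

definition F :: "nat \<Rightarrow> real" where "F i = measure Omega_inf {x \<in> {0..1}. j x < i}"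

text \<open>The branch of the rank map on \<open>D i\<close>, extended to all reals so that it is
  continuous and monotone.\<close>

definition f :: "nat \<Rightarrow> real \<Rightarrow> real" where "f i x = F i + mass_below (D i) x"

definition S :: "real \<Rightarrow> real" where "S x = f (j x) x"

text \<open>If a branch takes the same value at two points, it is constant between them and takes
  this value at a rational. Hence \<open>V\<close> contains all repeated values and the boundary
  values between levels.\<close>

definition V :: "real set" where "V = range F \<union> (\<Union>i. f i ` \<rat>)"

definition A :: "real set" where "A = {x \<in> {0..1}. S x \<notin> V}"

lemma pred_sets: "{x \<in> {0..1}. P (j x)} \<in> sets Omega_inf"
proof -
  have "{x \<in> space Omega_inf. P (j x)} \<in> sets Omega_inf" by measurable
  thus ?thesis by simp
qed

lemma D_sets: "D i \<in> sets Omega_inf"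
  unfolding D_def by (rule pred_sets)

lemma F_0 [simp]: "F 0 = 0" by (simp add: F_def)

lemma F_K: "F K = 1"
proof -
  have "{x \<in> {0..1}. j x < K} = {0..1}" using j_less by auto
  thus ?thesis by (simp add: F_def)
qed

lemma F_Suc: "F (Suc i) = F i + measure Omega_inf (D i)"
proof -
  have "{x \<in> {0..1}. j x < Suc i} = {x \<in> {0..1}. j x < i} \<union> D i" by (auto simp: D_def)
  moreover have "{x \<in> {0..1}. j x < i} \<inter> D i = {}" by (auto simp: D_def)
  ultimately show ?thesis unfolding F_def using pred_sets D_sets by (simp add: Inf.finite_measure_Union)
qed

lemma F_mono: "i \<le> l \<Longrightarrow> F i \<le> F l"
  unfolding F_def using pred_sets by (intro Inf.finite_measure_mono) auto

lemma F_nonneg: "0 \<le> F i" by (simp add: F_def)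

lemma F_le_1: "F i \<le> 1"
  unfolding F_def using Inf.bounded_measure by simp

lemma f_mono: "x \<le> y \<Longrightarrow> f i x \<le> f i y"
  unfolding f_def using mass_below_mono[OF D_sets] by simp

lemma f_0: "f i 0 = F i" and f_1: "f i 1 = F (Suc i)"
  by (simp_all add: f_def mass_below_0[OF D_sets] mass_below_1[OF D_sets] F_Suc)

lemma f_lipschitz: "\<bar>f i y - f i x\<bar> \<le> \<bar>y - x\<bar>"
  using mass_below_lipschitz[OF D_sets, of i y x] by (simp add: f_def)

lemma continuous_on_f: "continuous_on X (f i)"
  unfolding f_def
  by (intro continuous_intros continuous_on_subset[OF continuous_on_mass_below[OF D_sets]]) auto

lemma S_bounds: "x \<in> {0..1} \<Longrightarrow> F (j x) \<le> S x" "x \<in> {0..1} \<Longrightarrow> S x \<le> F (Suc (j x))"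
  unfolding S_def using f_mono[of 0 x "j x"] f_mono[of x 1 "j x"] by (simp_all add: f_0 f_1)

lemma S_in: "x \<in> {0..1} \<Longrightarrow> S x \<in> {0..1}"
  using S_bounds[of x] F_nonneg[of "j x"] F_le_1[of "Suc (j x)"] by auto

lemma S_measurable [measurable]: "S \<in> borel_measurable Omega_inf"
proof -
  have "f i \<in> borel_measurable Omega_inf" for i
    unfolding Omega_inf_def using continuous_on_f
    by (intro continuous_imp_measurable_on_sets_lebesgue) auto
  thus ?thesis unfolding S_def by (rule measurable_compose_countable) measurable
qed

text \<open>For \<open>t < 1\<close>, let \<open>i\<close> be the level with
  \<open>F i \<le> t < F (Suc i)\<close>. The sublevel set consists of all lower levels and the part
  of \<open>D i\<close> up to a cut \<open>m\<close> with \<open>f i m = t\<close>, and the masses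
  of these add up to \<open>f i m\<close>.\<close>

lemma measure_S_le:
  assumes "0 \<le> t" "t \<le> 1"
  shows "measure Omega_inf {x \<in> {0..1}. S x \<le> t} = t"
proof (cases "t = 1")
  case True
  have "S x \<le> t" if "x \<in> {0..1}" for x using S_in[OF that] True by simp
  hence "{x \<in> {0..1}. S x \<le> t} = {0..1}" by blast
  thus ?thesis using True by simp
next
  case False
  hence "t < F K" using assms F_K by simp
  define l where "l = (LEAST i. t < F i)"
  have l: "t < F l" unfolding l_def using \<open>t < F K\<close> by (rule LeastI)
  have "l \<noteq> 0" using l assms by (metis F_0 not_le)
  then obtain i where i: "l = Suc i" by (cases l) auto
  have Fi: "F i \<le> t" using not_less_Least[of i "\<lambda>i. t < F i"] i by (simp add: l_def)
  have "\<exists>x\<ge>0. x \<le> 1 \<and> f i x = t"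
    using Fi l i f_0 f_1 by (intro IVT') (auto intro: continuous_on_f)
  then obtain y where y: "y \<in> {0..1}" "f i y = t" by auto
  \<comment> \<open>The cut must be the largest solution in the interval: \<open>f i\<close> may
    stay equal to \<open>t\<close> beyond \<open>y\<close>, and those points of \<open>D i\<close>
    belong to the sublevel set too.\<close>
  define Z where "Z = {0..1} \<inter> f i -` {..t}"
  have "closed Z" unfolding Z_def
    by (intro continuous_closed_preimage continuous_on_f) auto
  hence "compact Z" unfolding compact_eq_bounded_closed by (auto simp: Z_def intro: bounded_subset)
  moreover have "y \<in> Z" using y by (simp add: Z_def)
  ultimately obtain m where m: "m \<in> Z" "\<And>x. x \<in> Z \<Longrightarrow> x \<le> m" using compact_attains_sup[of Z] by auto
  have fm: "f i m = t" using m f_mono[OF m(2)[OF \<open>y \<in> Z\<close>], of i] y by (auto simp: Z_def)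
  have eq: "{x \<in> {0..1}. S x \<le> t} = {x \<in> {0..1}. j x < i} \<union> (D i \<inter> {..m})"
  proof (intro equalityI subsetI)
    fix x assume x: "x \<in> {x \<in> {0..1}. S x \<le> t}"
    have "\<not> j x > i"
    proof
      assume "j x > i"
      hence "F l \<le> F (j x)" unfolding i by (intro F_mono) simp
      thus False using S_bounds(1)[of x] x l by auto
    qed
    moreover have "x \<le> m" if "j x = i" using x that m(2)[of x] by (auto simp: Z_def S_def)
    ultimately show "x \<in> {x \<in> {0..1}. j x < i} \<union> (D i \<inter> {..m})"
      using x by (cases "j x = i") (auto simp: D_def)
  next
    fix x assume "x \<in> {x \<in> {0..1}. j x < i} \<union> (D i \<inter> {..m})"
    thus "x \<in> {x \<in> {0..1}. S x \<le> t}"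
    proof
      assume x: "x \<in> {x \<in> {0..1}. j x < i}"
      hence "F (Suc (j x)) \<le> F i" by (intro F_mono) auto
      thus ?thesis using S_bounds(2)[of x] x Fi by auto
    next
      assume x: "x \<in> D i \<inter> {..m}"
      hence "f i x \<le> f i m" by (intro f_mono) auto
      thus ?thesis using x fm by (auto simp: D_def S_def)
    qed
  qed
  have "D i \<inter> {..m} \<in> sets Omega_inf" using D_sets by (auto simp: sets_Omega_inf_iff)
  moreover have "{x \<in> {0..1}. j x < i} \<inter> (D i \<inter> {..m}) = {}" by (auto simp: D_def)
  ultimately have "measure Omega_inf {x \<in> {0..1}. S x \<le> t} = F i + mass_below (D i) m"
    unfolding eq F_def mass_below_def using pred_sets by (intro Inf.finite_measure_Union) auto
  thus ?thesis using fm by (simp add: f_def)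
qed

lemma id_measurable: "(\<lambda>x. x) \<in> borel_measurable Omega_inf"
  unfolding Omega_inf_def by (intro continuous_imp_measurable_on_sets_lebesgue continuous_on_id) simp

text \<open>By \<open>measure_S_le\<close> both laws have the same distribution function, so
  \<open>S\<close> preserves the measure of Borel sets.\<close>

lemma distr_S: "distr Omega_inf borel S = distr Omega_inf borel (\<lambda>x. x)"
proof (rule cdf_unique')
  show "finite_borel_measure (distr Omega_inf borel S)" "finite_borel_measure (distr Omega_inf borel (\<lambda>x. x))"
    using Inf.finite_measure_distr[OF S_measurable] Inf.finite_measure_distr[OF id_measurable]
    by (auto simp: finite_borel_measure_def finite_borel_measure_axioms_def)
  show "cdf (distr Omega_inf borel S) = cdf (distr Omega_inf borel (\<lambda>x. x))"
  proof
    fix t :: real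
    have 1: "cdf (distr Omega_inf borel S) t = measure Omega_inf {x \<in> {0..1}. S x \<le> t}"
      unfolding cdf_def by (subst measure_distr) (auto intro!: arg_cong[where f = "measure Omega_inf"])
    have 2: "cdf (distr Omega_inf borel (\<lambda>x. x)) t = measure Omega_inf {x \<in> {0..1}. x \<le> t}"
      unfolding cdf_def using id_measurable
      by (subst measure_distr) (auto intro!: arg_cong[where f = "measure Omega_inf"])
    consider "t < 0" | "0 \<le> t" "t \<le> 1" | "1 < t" by linarith
    hence "measure Omega_inf {x \<in> {0..1}. S x \<le> t} = measure Omega_inf {x \<in> {0..1}. x \<le> t}"
    proof cases
      case 1
      hence "{x \<in> {0..1}. S x \<le> t} = {}" "{x \<in> {0..1}. x \<le> t} = {}" using S_in by fastforce+
      thus ?thesis by metis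
    next
      case 2
      have "{x \<in> {0..1}. x \<le> t} = {0..t}" using 2 by auto
      moreover have "measure Omega_inf {0..t} = t" using 2 by (subst measure_Omega_inf) auto
      ultimately show ?thesis using measure_S_le[OF 2] by metis
    next
      case 3
      hence "{x \<in> {0..1}. S x \<le> t} = {0..1}" "{x \<in> {0..1}. x \<le> t} = {0..1}" using S_in by fastforce+
      thus ?thesis by metis
    qed
    thus "cdf (distr Omega_inf borel S) t = cdf (distr Omega_inf borel (\<lambda>x. x)) t"
      using 1 2 by simp
  qed
qed

lemma S_preimage_borel:
  assumes "X \<in> sets borel"
  shows "S -` X \<inter> {0..1} \<in> sets Omega_inf"
    and "emeasure Omega_inf (S -` X \<inter> {0..1}) = emeasure Omega_inf (X \<inter> {0..1})"
proof -
  show "S -` X \<inter> {0..1} \<in> sets Omega_inf" using measurable_sets[OF S_measurable assms] by simp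
  have "emeasure Omega_inf (S -` X \<inter> {0..1}) = emeasure (distr Omega_inf borel S) X"
    using assms by (simp add: emeasure_distr)
  also have "\<dots> = emeasure (distr Omega_inf borel (\<lambda>x. x)) X" by (simp add: distr_S)
  also have "\<dots> = emeasure Omega_inf (X \<inter> {0..1})"
    using assms id_measurable by (simp add: emeasure_distr)
  finally show "emeasure Omega_inf (S -` X \<inter> {0..1}) = emeasure Omega_inf (X \<inter> {0..1})" .
qed

text \<open>A Lebesgue set is a Borel set together with part of a Borel null set; the preimage of
  the latter is null by the Borel case, and completeness handles its subsets.\<close>

lemma S_preimage:
  assumes X: "X \<in> sets Omega_inf"
  shows "S -` X \<inter> {0..1} \<in> sets Omega_inf"
    and "emeasure Omega_inf (S -` X \<inter> {0..1}) = emeasure Omega_inf X"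
proof -
  have X01: "X \<subseteq> {0..1}" using X by (simp add: sets_Omega_inf_iff)
  have "X \<in> sets lebesgue" using X by (simp add: sets_Omega_inf_iff)
  then obtain Y N N' where Y: "X = Y \<union> N" "N \<subseteq> N'" "N' \<in> null_sets lborel" "Y \<in> sets lborel"
    by (rule sets_completionE)
  have N': "N' \<in> sets borel" "Y \<in> sets borel" using Y by (auto simp: null_sets_def)
  have "emeasure Omega_inf (N' \<inter> {0..1}) \<le> emeasure lebesgue N'"
    using N' by (subst emeasure_Omega_inf) (auto intro!: emeasure_mono)
  also have "\<dots> = 0" using Y(3) by (simp add: null_sets_def)
  finally have N0: "emeasure Omega_inf (N' \<inter> {0..1}) = 0" by simp
  have NN: "S -` N' \<inter> {0..1} \<in> null_sets Omega_inf"
    using S_preimage_borel[OF N'(1)] N0 by (auto simp: null_sets_def)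
  have sub: "S -` N \<inter> {0..1} \<subseteq> S -` N' \<inter> {0..1}" using Y(2) by auto
  have leb: "S -` N' \<inter> {0..1} \<in> null_sets lebesgue"
    using NN by (auto simp: null_sets_def sets_Omega_inf_iff emeasure_Omega_inf)
  hence "S -` N \<inter> {0..1} \<in> null_sets lebesgue" using sub by (rule completion.complete2[rotated])
  hence SN: "S -` N \<inter> {0..1} \<in> null_sets Omega_inf"
    by (auto simp: null_sets_def sets_Omega_inf_iff emeasure_Omega_inf)
  have "N \<in> null_sets lebesgue"
    using completion.complete2[OF Y(2)] Y(3) by (auto intro: null_sets_completionI)
  hence N: "N \<in> null_sets Omega_inf"
    using X01 Y(1) by (auto simp: null_sets_def sets_Omega_inf_iff emeasure_Omega_inf)
  have eq: "S -` X \<inter> {0..1} = (S -` Y \<inter> {0..1}) \<union> (S -` N \<inter> {0..1})" using Y(1) by auto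
  show "S -` X \<inter> {0..1} \<in> sets Omega_inf"
    unfolding eq using S_preimage_borel(1)[OF N'(2)] SN by auto
  have Ys: "Y \<in> sets Omega_inf" "Y \<inter> {0..1} = Y" using N'(2) X01 Y(1) by (auto simp: sets_Omega_inf_iff)
  show "emeasure Omega_inf (S -` X \<inter> {0..1}) = emeasure Omega_inf X"
    unfolding eq using emeasure_Un_null_set[OF S_preimage_borel(1)[OF N'(2)] SN]
      S_preimage_borel(2)[OF N'(2)] emeasure_Un_null_set[OF Ys(1) N] Ys(2) Y(1) by simp
qed

lemma countable_V: "countable V"
  unfolding V_def by (intro countable_Un countable_UN countable_image countable_rat) auto

lemma V_null: "V \<in> null_sets lborel"
  using countable_V by (rule countable_imp_null_set_lborel)

lemma A_sets: "A \<in> sets Omega_inf" and AE_A: "AE x in Omega_inf. x \<in> A"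
proof -
  have V: "V \<in> sets borel" using V_null by (simp add: null_sets_def)
  have A: "A = {0..1} - (S -` V \<inter> {0..1})" by (auto simp: A_def)
  have "S -` V \<inter> {0..1} \<in> sets Omega_inf" by (rule S_preimage_borel[OF V])
  thus "A \<in> sets Omega_inf" unfolding A using sets.top[of Omega_inf] by (intro sets.Diff) auto
  have "V \<inter> {0..1} \<in> null_sets lborel" using V_null by (rule null_set_Int2) simp
  hence "emeasure Omega_inf (V \<inter> {0..1}) = 0" by (subst emeasure_Omega_inf) (auto simp: null_sets_def)
  hence "S -` V \<inter> {0..1} \<in> null_sets Omega_inf"
    using S_preimage_borel[OF V] by (auto simp: null_sets_def)
  hence "AE x in Omega_inf. x \<notin> S -` V \<inter> {0..1}" by (rule AE_not_in)
  moreover have "AE x in Omega_inf. x \<in> {0..1}" using AE_space[of Omega_inf] by simp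
  ultimately show "AE x in Omega_inf. x \<in> A" unfolding A by eventually_elim simp
qed

lemma S_strict_bounds:
  assumes "x \<in> A"
  shows "F (j x) < S x" "S x < F (Suc (j x))"
proof -
  have x: "x \<in> {0..1}" "S x \<noteq> F (j x)" "S x \<noteq> F (Suc (j x))"
    using assms by (auto simp: A_def V_def)
  show "F (j x) < S x" "S x < F (Suc (j x))" using S_bounds[OF x(1)] x(2,3) by auto
qed

text \<open>Off \<open>V\<close>, different levels have values in disjoint open intervals. Equal
  values within one level would also be taken at a rational in between and so lie in
  \<open>V\<close>.\<close>

lemma S_inj: "inj_on S A"
proof -
  have False if xy: "x \<in> A" "y \<in> A" "S x = S y" "x < y" for x y
  proof -
    have "j x = j y"
    proof (rule ccontr)
      assume "j x \<noteq> j y"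
      hence "F (Suc (j x)) \<le> F (j y) \<or> F (Suc (j y)) \<le> F (j x)" using F_mono by (metis Suc_leI nat_neq_iff)
      thus False using S_strict_bounds[OF xy(1)] S_strict_bounds[OF xy(2)] xy(3) by linarith
    qed
    obtain q where q: "q \<in> \<rat>" "x < q" "q < y" using Rats_dense_in_real[OF xy(4)] by auto
    have "f (j x) x \<le> f (j x) q" "f (j x) q \<le> f (j x) y" using q by (auto intro!: f_mono)
    hence "S x = f (j x) q" using xy(3) \<open>j x = j y\<close> by (simp add: S_def)
    hence "S x \<in> V" using q(1) by (auto simp: V_def)
    thus False using xy(1) by (simp add: A_def)
  qed
  thus ?thesis by (metis inj_onI linorder_neqE_linordered_idom)
qed

text \<open>On each level \<open>S\<close> agrees with a Lipschitz function; such functions map null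
  sets to null sets and therefore Lebesgue sets to Lebesgue sets.\<close>

lemma S_image:
  assumes X: "X \<in> sets Omega_inf"
  shows "S ` X \<in> sets Omega_inf"
proof -
  have X01: "X \<subseteq> {0..1}" using X by (simp add: sets_Omega_inf_iff)
  have "f i ` (X \<inter> D i) \<in> sets lebesgue" for i
  proof (rule sets_lebesgue_continuous_image[where S = UNIV])
    show "X \<inter> D i \<in> sets lebesgue" using X D_sets[of i] by (auto simp: sets_Omega_inf_iff)
    show "negligible (f i ` Y)" if "negligible Y" for Y
      using that f_lipschitz[of i]
      by (intro negligible_locally_Lipschitz_image exI[of _ "UNIV :: real set"] exI[of _ "1 :: real"]) auto
  qed (auto intro: continuous_on_f)
  hence "(\<Union>i. f i ` (X \<inter> D i)) \<in> sets lebesgue" by blast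
  moreover have "(\<Union>i. f i ` (X \<inter> D i)) = S ` X"
    using X01 by (fastforce simp: S_def D_def)
  ultimately show ?thesis using X01 S_in by (auto simp: sets_Omega_inf_iff)
qed

lemma S_in_Aut: "S \<in> Aut Omega_inf"
proof (rule AutI[of A Omega_inf "S ` A"])
  show SA: "S ` A \<in> sets Omega_inf" using S_image A_sets .
  show "bij_betw S A (S ` A)" using S_inj by (simp add: bij_betw_def)
  have A01: "A \<subseteq> {0..1}" by (auto simp: A_def)
  have Ae: "emeasure Omega_inf (X \<inter> A) = emeasure Omega_inf X" "X \<inter> A \<in> sets Omega_inf"
    if "X \<in> sets Omega_inf" for X
  proof -
    show *: "X \<inter> A \<in> sets Omega_inf" using that A_sets by auto
    show "emeasure Omega_inf (X \<inter> A) = emeasure Omega_inf X"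
      using AE_A by (intro emeasure_eq_AE *) (auto simp: that elim: eventually_mono)
  qed
  \<comment> \<open>The image of \<open>A\<close> has full measure because its preimage contains
    \<open>A\<close> and has the same measure as the image.\<close>
  have "emeasure Omega_inf {0..1} = emeasure Omega_inf A" using Ae(1)[of "{0..1}"] A01
    by (simp add: Int_absorb1 sets_Omega_inf_iff)
  also have "\<dots> \<le> emeasure Omega_inf (S -` (S ` A) \<inter> {0..1})"
    using A01 S_preimage(1)[OF SA] by (intro emeasure_mono) auto
  also have "\<dots> = emeasure Omega_inf (S ` A)" by (rule S_preimage(2)[OF SA])
  finally have ge: "measure Omega_inf (S ` A) \<ge> 1" by (simp add: Inf.emeasure_eq_measure)
  have "measure Omega_inf ({0..1} - S ` A) = 1 - measure Omega_inf (S ` A)"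
    using Inf.finite_measure_compl[OF SA] by simp
  hence "measure Omega_inf ({0..1} - S ` A) = 0"
    using ge measure_nonneg[of Omega_inf "{0..1} - S ` A"] by linarith
  hence "emeasure Omega_inf (space Omega_inf - S ` A) = 0" by (simp add: Inf.emeasure_eq_measure)
  moreover have "space Omega_inf - S ` A \<in> sets Omega_inf" using SA by (rule sets.compl_sets)
  ultimately show "AE y in Omega_inf. y \<in> S ` A" by (rule AE_I[rotated]) auto
  fix X assume X: "X \<in> sets Omega_inf"
  have eq: "S -` X \<inter> A = (S -` X \<inter> {0..1}) \<inter> A" using A01 by auto
  show "S -` X \<inter> A \<in> sets Omega_inf" "emeasure Omega_inf (S -` X \<inter> A) = emeasure Omega_inf X"
    unfolding eq using Ae[OF S_preimage(1)[OF X]] S_preimage(2)[OF X] by auto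
  show "S ` X \<in> sets Omega_inf" using X by (rule S_image)
qed (rule A_sets AE_A)+

text \<open>The half turn is the rotation by 1/2 conjugated by the rank map.\<close>

lemma exists_half_turn:
  "\<exists>T\<in>Aut Omega_inf. AE x in Omega_inf. x \<in> A \<and> T x \<in> A \<and> \<bar>S (T x) - S x\<bar> = 1 / 2"
proof -
  obtain S' where S': "S' \<in> Aut Omega_inf" "AE y in Omega_inf. S (S' y) = y"
    using Aut_inv[OF S_in_Aut] by auto
  define T where "T = S' \<circ> (half_shift \<circ> S)"
  have HS: "half_shift \<circ> S \<in> Aut Omega_inf" by (rule Aut_comp[OF S_in_Aut half_shift_in_Aut])
  have T: "T \<in> Aut Omega_inf" unfolding T_def by (rule Aut_comp[OF HS S'(1)])
  have "AE x in Omega_inf. S (T x) = half_shift (S x)"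
    using Aut_AE[OF HS S'(2)] by (simp add: T_def)
  moreover have "AE x in Omega_inf. T x \<in> A" using T AE_A by (rule Aut_AE)
  ultimately have "AE x in Omega_inf. x \<in> A \<and> T x \<in> A \<and> \<bar>S (T x) - S x\<bar> = 1 / 2"
    using AE_A by eventually_elim (auto simp: half_shift_def)
  thus ?thesis using T by blast
qed

text \<open>\<open>S x\<close> and \<open>S y\<close> lie strictly inside the rank intervals of
  their levels. So the levels from \<open>j x\<close> to \<open>j y\<close> span more than 1/2, and
  the levels strictly between them less than 1/2, whose complement is the other arc.\<close>

lemma measure_arcs_gt_half:
  assumes "x \<in> A" "y \<in> A" "S y - S x = 1 / 2"
  shows "j x \<le> j y" "measure Omega_inf {v \<in> {0..1}. j x \<le> j v \<and> j v \<le> j y} > 1 / 2"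
    "measure Omega_inf {v \<in> {0..1}. j y \<le> j v \<or> j v \<le> j x} > 1 / 2"
proof -
  note bx = S_strict_bounds[OF assms(1)] and b_y = S_strict_bounds[OF assms(2)]
  show le: "j x \<le> j y"
  proof (rule ccontr)
    assume "\<not> j x \<le> j y"
    hence "F (Suc (j y)) \<le> F (j x)" by (intro F_mono) simp
    thus False using bx b_y assms(3) by linarith
  qed
  have "{v \<in> {0..1}. j x \<le> j v \<and> j v \<le> j y} = {v \<in> {0..1}. j v < Suc (j y)} - {v \<in> {0..1}. j v < j x}"
    by auto
  moreover have "measure Omega_inf ({v \<in> {0..1}. j v < Suc (j y)} - {v \<in> {0..1}. j v < j x}) = F (Suc (j y)) - F (j x)"
    unfolding F_def using le pred_sets by (intro Inf.finite_measure_Diff) auto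
  ultimately show "measure Omega_inf {v \<in> {0..1}. j x \<le> j v \<and> j v \<le> j y} > 1 / 2"
    using bx b_y assms(3) by simp
  show "measure Omega_inf {v \<in> {0..1}. j y \<le> j v \<or> j v \<le> j x} > 1 / 2"
  proof (cases "j x = j y")
    case True
    hence "{v \<in> {0..1}. j y \<le> j v \<or> j v \<le> j x} = {0..1}" by auto
    thus ?thesis by simp
  next
    case False
    hence "{v \<in> {0..1}. j y \<le> j v \<or> j v \<le> j x} = {0..1} - ({v \<in> {0..1}. j v < j y} - {v \<in> {0..1}. j v < Suc (j x)})"
      by auto
    moreover have "measure Omega_inf ({v \<in> {0..1}. j v < j y} - {v \<in> {0..1}. j v < Suc (j x)}) = F (j y) - F (Suc (j x))"
      unfolding F_def using le False pred_sets by (intro Inf.finite_measure_Diff) auto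
    moreover have "measure Omega_inf ({0..1} - ({v \<in> {0..1}. j v < j y} - {v \<in> {0..1}. j v < Suc (j x)})) =
        1 - measure Omega_inf ({v \<in> {0..1}. j v < j y} - {v \<in> {0..1}. j v < Suc (j x)})"
      using Inf.finite_measure_compl[of "{v \<in> {0..1}. j v < j y} - {v \<in> {0..1}. j v < Suc (j x)}"] pred_sets
      by (simp add: sets.Diff)
    ultimately show ?thesis using bx b_y assms(3) by simp
  qed
qed

end

section \<open>The value for the unit interval\<close>

text \<open>As Lebesgue measure has no atoms, the points at \<open>z\<close> can be split in any
  proportion, so no parity condition arises. Ranking the points by the slots of their directions
  yields the half turn.\<close>

lemma LamSup_Omega_inf_ge:
  assumes g [measurable]: "g \<in> borel_measurable Omega_inf"
  shows "sqrt 3 / 2 \<le> LamSup Omega_inf g"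
proof (rule LamSup_ge_if_angles_large[OF nontriv_Omega_inf])
  fix k :: real assume k: "0 < k" "k < 3 / 4"
  then obtain K where K: "K \<ge> 6" "- cos (pi / 3 + 4 * pi / real K) \<le> 1 - 2 * k"
    using eventually_slots_fine by blast
  obtain z where z: "\<And>d. norm d = 1 \<Longrightarrow> measure Omega_inf {x \<in> space Omega_inf. g x - z \<in> sector d}
      \<le> measure Omega_inf (space Omega_inf) / 2"
    using Inf.exists_balanced_apex[OF g] by blast
  have "\<exists>u \<in> borel_measurable Omega_inf.
      (\<forall>x\<in>space Omega_inf. norm (u x) = 1 \<and> (g x \<noteq> z \<longrightarrow> u x = sgn (g x - z))) \<and>
      (\<forall>d. norm d = 1 \<longrightarrow> measure Omega_inf {x \<in> space Omega_inf. u x \<in> sector d} \<le> measure Omega_inf (space Omega_inf) / 2)"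
  proof (rule Inf.exists_balanced_directions[OF g z])
    let ?p = "SUP d\<in>sphere 0 1. measure Omega_inf {x \<in> space Omega_inf. g x - z \<in> sector d}"
    have "?p \<le> measure Omega_inf (space Omega_inf) / 2" using z by (intro cSUP_least) auto
    moreover assume "measure Omega_inf {x \<in> space Omega_inf. g x = z} > measure Omega_inf (space Omega_inf) / 2 - ?p"
    moreover have "{x \<in> space Omega_inf. g x = z} \<in> sets Omega_inf" by measurable
    ultimately show "\<exists>C\<in>sets Omega_inf. C \<subseteq> {x \<in> space Omega_inf. g x = z} \<and>
        measure Omega_inf C = measure Omega_inf (space Omega_inf) / 2 - ?p"
      by (intro Omega_inf_subset_of_measure) auto
  qed
  then obtain u where u [measurable]: "u \<in> borel_measurable Omega_inf"
    and unit: "\<And>x. x \<in> {0..1} \<Longrightarrow> norm (u x) = 1" and sgn: "\<And>x. x \<in> {0..1} \<Longrightarrow> g x \<noteq> z \<Longrightarrow> u x = sgn (g x - z)"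
    and bal: "\<And>d. norm d = 1 \<Longrightarrow> measure Omega_inf {x \<in> space Omega_inf. u x \<in> sector d}
        \<le> measure Omega_inf (space Omega_inf) / 2"
    by auto
  interpret rank_map "\<lambda>x. slot K (u x)" K
  proof
    show "(\<lambda>x. slot K (u x)) \<in> measurable Omega_inf (count_space UNIV)" by measurable
    show "slot K (u x) < K" for x using K(1) by (intro slot_bounds(3)) simp
  qed
  have far: "u x \<bullet> u y \<le> 1 - 2 * k" if "x \<in> A" "y \<in> A" "S y - S x = 1 / 2" for x y
  proof -
    have "u x \<bullet> u y \<le> - cos (pi / 3 + 4 * pi / real K)"
    proof (rule Inf.slots_far_apart[OF bal u])
      show "norm (u x) = 1" "norm (u y) = 1" using that(1,2) unit by (auto simp: A_def)
      show "slot K (u x) \<le> slot K (u y)" by (rule measure_arcs_gt_half(1)[OF that])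
      show "measure Omega_inf (space Omega_inf) / 2 <
          measure Omega_inf {v \<in> space Omega_inf. slot K (u x) \<le> slot K (u v) \<and> slot K (u v) \<le> slot K (u y)}"
        using measure_arcs_gt_half(2)[OF that] by simp
      show "measure Omega_inf (space Omega_inf) / 2 <
          measure Omega_inf {v \<in> space Omega_inf. slot K (u y) \<le> slot K (u v) \<or> slot K (u v) \<le> slot K (u x)}"
        using measure_arcs_gt_half(3)[OF that] by simp
    qed (use unit K(1) in simp_all)
    thus ?thesis using K(2) by simp
  qed
  obtain T where T: "T \<in> Aut Omega_inf"
    and half: "AE x in Omega_inf. x \<in> A \<and> T x \<in> A \<and> \<bar>S (T x) - S x\<bar> = 1 / 2"
    using exists_half_turn by auto
  have "AE x in Omega_inf. g x \<noteq> z \<longrightarrow> g (T x) \<noteq> z \<longrightarrow> sgn (g x - z) \<bullet> sgn (g (T x) - z) \<le> 1 - 2 * k"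
    using half
  proof eventually_elim
    case (elim x)
    \<comment> \<open>Past rank 1/2 the rotation wraps around, and then \<open>x\<close> is the one
      ahead; the inner product does not depend on the order.\<close>
    hence "S (T x) - S x = 1 / 2 \<or> S x - S (T x) = 1 / 2" by linarith
    hence "u x \<bullet> u (T x) \<le> 1 - 2 * k"
      using far[of x "T x"] far[of "T x" x] elim by (auto simp: inner_commute)
    thus ?case using elim sgn[of x] sgn[of "T x"] by (auto simp: A_def)
  qed
  thus "\<exists>T\<in>Aut Omega_inf. \<exists>z. AE x in Omega_inf. g x \<noteq> z \<longrightarrow> g (T x) \<noteq> z \<longrightarrow>
      sgn (g x - z) \<bullet> sgn (g (T x) - z) \<le> 1 - 2 * k"
    using T by blast
qed

lemma Omega_inf_extremal:
  "LamInf Omega_inf = sqrt 3 / 2 \<and> (\<exists>g T z. g \<in> Linf Omega_inf \<and> T \<in> Aut Omega_inf \<and>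
    Lam Omega_inf g T z = LamSup Omega_inf g \<and> LamSup Omega_inf g = LamInf Omega_inf)"
proof -
  define c where "c = (\<lambda>x::real. if x < 1 / 3 then 0 else if x < 2 / 3 then 1 else (2::nat))"
  have [measurable]: "(\<lambda>x. x) \<in> borel_measurable Omega_inf"
    unfolding Omega_inf_def by (intro continuous_imp_measurable_on_sets_lebesgue) (auto intro: continuous_intros)
  have c: "c \<in> measurable Omega_inf (count_space UNIV)" unfolding c_def by measurable
  have small: "measure Omega_inf {x \<in> space Omega_inf. c x = i} < measure Omega_inf (space Omega_inf) / 2"
    if "i < 3" for i
  proof -
    have "i = 0 \<or> i = 1 \<or> i = 2" using that by linarith
    then obtain a where a: "{x \<in> {0..1}. c x = i} \<subseteq> {a..a + 1 / 3}" "0 \<le> a" "a \<le> 2 / 3"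
    proof (elim disjE)
      assume "i = 0" thus thesis by (intro that[of 0]) (auto simp: c_def split: if_splits)
    next
      assume "i = 1" thus thesis by (intro that[of "1/3"]) (auto simp: c_def split: if_splits)
    next
      assume "i = 2" thus thesis by (intro that[of "2/3"]) (auto simp: c_def split: if_splits)
    qed
    have "measure Omega_inf {x \<in> {0..1}. c x = i} \<le> measure Omega_inf {a..a + 1 / 3}"
      using a by (intro Inf.finite_measure_mono) (auto simp: sets_Omega_inf_iff)
    also have "\<dots> = 1 / 3" using a by (subst measure_Omega_inf) auto
    finally show ?thesis by simp
  qed
  \<comment> \<open>A shift by 1/2 in either direction leaves an interval of length 1/3.\<close>
  have "AE x in Omega_inf. c (half_shift x) \<noteq> c x"
    by (intro AE_I2) (auto simp: c_def half_shift_def)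
  thus ?thesis
    using c small half_shift_in_Aut LamSup_Omega_inf_ge
    by (intro Inf.three_points_extremal[where c = c and T = half_shift] nontriv_Omega_inf) (auto simp: c_def)
qed

theorem theoremA1:
  shows "LamInf (Omega_fin 1) = 1 \<and> LamInf (Omega_fin 2) = 1 \<and>
    sqrt 3 / 2 \<le> LamInf (Omega_fin 4) \<and> LamInf (Omega_fin 4) \<le> 1 \<and>
    (\<forall>n::nat. n \<ge> 1 \<and> n \<notin> {1, 2, 4} \<longrightarrow> LamInf (Omega_fin n) = sqrt 3 / 2) \<and>
    LamInf Omega_inf = sqrt 3 / 2 \<and>
    (\<forall>n::nat. n \<ge> 1 \<and> n \<noteq> 4 \<longrightarrow>
       (\<exists>g T z. g \<in> Linf (Omega_fin n) \<and> T \<in> Aut (Omega_fin n) \<and>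
          Lam (Omega_fin n) g T z = LamSup (Omega_fin n) g \<and>
          LamSup (Omega_fin n) g = LamInf (Omega_fin n))) \<and>
    (\<exists>g T z. g \<in> Linf Omega_inf \<and> T \<in> Aut Omega_inf \<and>
          Lam Omega_inf g T z = LamSup Omega_inf g \<and>
          LamSup Omega_inf g = LamInf Omega_inf)"
proof (intro conjI allI impI)
  show "LamInf (Omega_fin 1) = 1" using Omega_fin_1 by (rule conjunct1)
  show "LamInf (Omega_fin 2) = 1" using Omega_fin_2 by (rule conjunct1)
  show "sqrt 3 / 2 \<le> LamInf (Omega_fin 4)"
    by (intro LamInf_ge[OF nontriv_Omega_fin] LamSup_Omega_fin_ge) auto
  show "LamInf (Omega_fin 4) \<le> 1" by (rule LamInf_le_1[OF nontriv_Omega_fin]) simp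
  show "LamInf Omega_inf = sqrt 3 / 2" using Omega_inf_extremal by (rule conjunct1)
  show "\<exists>g T z. g \<in> Linf Omega_inf \<and> T \<in> Aut Omega_inf \<and>
          Lam Omega_inf g T z = LamSup Omega_inf g \<and> LamSup Omega_inf g = LamInf Omega_inf"
    using Omega_inf_extremal by (rule conjunct2)
next
  fix n :: nat assume "n \<ge> 1 \<and> n \<notin> {1, 2, 4}"
  hence "n \<ge> 3" "n \<noteq> 4" by auto
  thus "LamInf (Omega_fin n) = sqrt 3 / 2" using Omega_fin_extremal[THEN conjunct1] by blast
next
  fix n :: nat assume "n \<ge> 1 \<and> n \<noteq> 4"
  then consider "n = 1" | "n = 2" | "n \<ge> 3" "n \<noteq> 4" by linarith
  thus "\<exists>g T z. g \<in> Linf (Omega_fin n) \<and> T \<in> Aut (Omega_fin n) \<and>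
          Lam (Omega_fin n) g T z = LamSup (Omega_fin n) g \<and> LamSup (Omega_fin n) g = LamInf (Omega_fin n)"
  proof cases
    case 1 show ?thesis unfolding 1 using Omega_fin_1 by (rule conjunct2)
  next
    case 2 show ?thesis unfolding 2 using Omega_fin_2 by (rule conjunct2)
  next
    case 3 thus ?thesis using Omega_fin_extremal[THEN conjunct2] by blast
  qed
qed

end
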